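(* Let $r>0$, $0<\epsilon \leq \frac{1}{4 \sqrt{2}}$, and $T = d = \left\lfloor \frac{1}{32} \frac{\zeta_r}{\epsilon^2} \right\rfloor$, where $\zeta_r=\frac{r}{\tanh(r)}$. Let $\theta\in(0,\frac{\pi}{2})$ be such that $\epsilon=\frac14\cos(\theta)$, let $M=\frac{2}{\cos(\theta)}$, and let $f \colon \mathbb{H}^d \to \mathbb{R}$ be the globally g-convex and $M$-Lipschitz function $$f(x) = \mathrm{dist}(x, x^* ) + \max_{i=0, \ldots, d-2} \left\{ \frac{1}{\cos(\theta)} \mathrm{dist}(x, L_{i, x^*})\right\},$$ with $x^*\in S_{d-1}$ and half-spaces $L_{i,x^*}$ as defined in the context. For any deterministic first-order algorithm $\mathcal{A}$ satisfying assumptions A1 and A2 (stated in the context), there is an oracle for $f$ such that running $\mathcal{A}$ with that oracle produces iterates $x_0, x_1, \ldots$ satisfying $f(x_k) - f^* \geq \epsilon M r$ for all $k = 0, \ldots, T-1$, where $f^*=\min f$.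
   Context: Hyperbolic space $\mathbb{H}^d$ ($d\ge2$, curvature $-1$) is identified with the hyperboloid $\mathcal{M}=\{x\in\mathbb{R}^{d+1}:\langle x,x\rangle=-1,\langle x,e_0\rangle<0\}$ (the sheet containing $e_0$), where $\langle x,y\rangle=x^\top\mathrm{diag}(-1,1,\ldots,1)y$ and $e_0,\ldots,e_d$ is the standard basis of $\mathbb{R}^{d+1}$. Tangent spaces are $\mathrm{T}_x\mathcal{M}=\{v:\langle x,v\rangle=0\}$ with inner product $\langle\cdot,\cdot\rangle$. $\exp_x$ is the exponential map, $\log_x$ its inverse, $P_{x\to y}$ parallel transport along the geodesic from $x$ to $y$. For $(x_1,v_1),\ldots,(x_m,v_m)\in\mathrm{T}\mathcal{M}$ let $\mathrm{gspan}(x_1,\ldots,x_m,v_1,\ldots,v_m)=\mathcal{M}\cap\mathrm{span}(x_1,\ldots,x_m,v_1,\ldots,v_m)$ (the definition applies likewise with only points). A function is g-convex if it is convex along all geodesics. $\partial f(x)$ is the set of $g\in\mathrm{T}_x\mathcal{M}$ with $f(y)\ge f(x)+\langle g,\log_x(y)\rangle$ for all $y$. An oracle for $f$ answers a query $x$ with $f(x)$ and some $g\in\partial f(x)$. A deterministic first-order algorithm chooses $x_k$ as a function of the past information $(f(x_\ell),x_\ell,g_\ell)_{\ell<k}$, where $g_\ell\in \partial f(x_\ell)$ are the oracle's answers. Construction. Let $x_{\mathrm{ref}}=e_0$, $y_0=x_{\mathrm{ref}}$, $r_0=r$, $S_0=\{x:\mathrm{dist}(x,y_0)=r\}$, and $e_i^{(0)}=e_i\in\mathrm{T}_{y_0}\mathcal{M}$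 for $i=1,\ldots,d$. For $k=1,\ldots,d-1$ define inductively: $\Delta_{k-1}>0$ and $r_k>0$ by $\cos(\theta)=\tanh(\Delta_{k-1})/\tanh(r_{k-1})$ and $\sin(\theta)=\sinh(r_k)/\sinh(r_{k-1})$; $y_k=\exp_{y_{k-1}}(\Delta_{k-1}e_k^{(k-1)})$; $e_i^{(k)}=P_{y_{k-1}\to y_k}e_i^{(k-1)}$ for $i=1,\ldots,d$; and $S_k$ the set of all points $x^*\in S_{k-1}$ such that the angle between $e_k^{(k-1)}$ and $\log_{y_{k-1}}(x^* )$ equals $\theta$. Let $I_k=\mathrm{gspan}(y_0,\ldots,y_k)$. The set $S_{d-1}$ consists of two points; fix $x^*\in S_{d-1}$ (so $x^* \in S_k$ for all $k\le d-1$). For $k=0,\ldots,d-2$ let $$V_{k,x^*}=\frac{1}{\cos(\theta)}e_{k+1}^{(k)}-\frac{\log_{y_k}(x^* )}{\mathrm{dist}(y_k,x^* )},\qquad L_{k,x^*}=\exp_{y_k}(\{v\in\mathrm{T}_{y_k}\mathcal{M}:\langle V_{k,x^*},v\rangle\ge0\}).$$ Oracle used: if $k\le d-2$ and the $k$-th query satisfies $x_k\in I_k\cap\bigcap_{\ell=0}^{d-2}L_{\ell,x^*}$, the returned subgradient is $g_k=\hat g_k-\frac{\log_{x_k}(x^* )}{\mathrm{dist}(x_k,x^* )}$, where $\hat g_k=-\frac{\sin(\theta_{x_k})}{\cos(\theta)}P_{y_k\to x_k}\frac{V_{k,x^*}}{\|V_{k,x^*}\|}$ and $\theta_{x_k}$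 is the angle at $x_k$ between $\log_{x_k}(y_{k+1})$ and $\log_{x_k}(x^* )$; here $\hat g_k$ is a subgradient at $x_k$ of $x\mapsto\frac{1}{\cos(\theta)}\mathrm{dist}(x,L_{k,x^*})$ and $g_k$ is tangent to $I_{k+1}$. Otherwise it returns any subgradient of $f$. A1: the algorithm queries $x_0=x_{\mathrm{ref}}$ and $x_k\in\mathrm{gspan}(x_0,\ldots,x_{k-1},g_0,\ldots,g_{k-1})$ for all $k\ge1$. A2: when run on the oracle for $f$ which answers the $j$-th query $x_j$ with $f(x_j)$ and the subgradient $g_j=-\frac{\sin(\theta_{x_j})}{\cos(\theta)}P_{y_j\to x_j}\frac{V_{j,x^*}}{\|V_{j,x^*}\|}-\frac{\log_{x_j}(x^* )}{\mathrm{dist}(x_j,x^* )}$ (with $\theta_{x_j}$ the angle at $x_j$ between $\log_{x_j}(y_{j+1})$ and $\log_{x_j}(x^* )$) if $j\le d-2$ and $x_j\in I_j\cap\bigcap_{\ell=0}^{d-2}L_{\ell,x^*}$, and with $f(x_j)$ and any subgradient of $f$ at $x_j$ otherwise, for each $k\le d-1$ the algorithm queries $x_k\in\bigcap_{\ell=0}^{k-1}L_{\ell,x^*}$. *)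

theory Defs
  imports "HOL-Analysis.Analysis"
begin

section \<open>The hyperboloid model\<close>

text \<open>
  The ambient space \<open>\<real>\<^bsup>d+1\<^esup>\<close> is \<open>real \<times> 'a\<close> with \<open>DIM('a) = d\<close>; the first component is
  the coordinate along \<open>e\<^sub>0\<close>. The \<open>e\<^sub>0\<close>-part carries the negative sign.
\<close>

definition mink :: "real \<times> 'a::euclidean_space \<Rightarrow> real \<times> 'a \<Rightarrow> real" where
  "mink x y = - (fst x * fst y) + snd x \<bullet> snd y"

definition e0 :: "real \<times> 'a::euclidean_space" where
  "e0 = (1, 0)"

definition hyp :: "(real \<times> 'a::euclidean_space) set" where
  "hyp = {x. mink x x = - 1 \<and> mink x e0 < 0}"

definition tangent :: "real \<times> 'a::euclidean_space \<Rightarrow> (real \<times> 'a) set" where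
  "tangent x = {v. mink x v = 0}"

text \<open>Only meant for tangent vectors, where the Minkowski form is positive definite.\<close>

definition mnorm :: "real \<times> 'a::euclidean_space \<Rightarrow> real" where
  "mnorm v = sqrt (mink v v)"

definition hangle :: "real \<times> 'a::euclidean_space \<Rightarrow> real \<times> 'a \<Rightarrow> real" where
  "hangle u v = arccos (mink u v / (mnorm u * mnorm v))"

text \<open>
  The geodesic with initial point \<open>x\<close> and initial velocity \<open>v\<close> is
  \<open>t \<mapsto> cosh (t \<parallel>v\<parallel>) x + sinh (t \<parallel>v\<parallel>) v / \<parallel>v\<parallel>\<close>. For \<open>v = 0\<close> the second summand below is \<open>0\<close>.
\<close>

definition hexp :: "real \<times> 'a::euclidean_space \<Rightarrow> real \<times> 'a \<Rightarrow> real \<times> 'a" where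
  "hexp x v = cosh (mnorm v) *\<^sub>R x + (sinh (mnorm v) / mnorm v) *\<^sub>R v"

definition hlog :: "real \<times> 'a::euclidean_space \<Rightarrow> real \<times> 'a \<Rightarrow> real \<times> 'a" where
  "hlog x = inv_into (tangent x) (hexp x)"

text \<open>The geodesic distance in curvature \<open>-1\<close>: \<open>cosh (dist x y) = - \<langle>x, y\<rangle>\<close>.\<close>

definition hdist :: "real \<times> 'a::euclidean_space \<Rightarrow> real \<times> 'a \<Rightarrow> real" where
  "hdist x y = arcosh (- mink x y)"

definition hdist_set :: "real \<times> 'a::euclidean_space \<Rightarrow> (real \<times> 'a) set \<Rightarrow> real" where
  "hdist_set x L = (INF y\<in>L. hdist x y)"

text \<open>
  The covariant derivative of a tangent field along a curve is the tangential part of its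
  derivative in the ambient space. The normal space of the hyperboloid at \<open>p\<close> is spanned by \<open>p\<close>,
  so a field is parallel along \<open>\<gamma>\<close> iff its ambient derivative at \<open>t\<close> is a multiple of \<open>\<gamma> t\<close>.
\<close>

definition parallel_along ::
    "(real \<Rightarrow> real \<times> 'a::euclidean_space) \<Rightarrow> (real \<Rightarrow> real \<times> 'a) \<Rightarrow> bool" where
  "parallel_along \<gamma> V \<longleftrightarrow>
     (\<forall>t\<in>{0..1}. V t \<in> tangent (\<gamma> t) \<and>
        (\<exists>c. (V has_vector_derivative c *\<^sub>R \<gamma> t) (at t within {0..1})))"

definition ptrans ::
    "real \<times> 'a::euclidean_space \<Rightarrow> real \<times> 'a \<Rightarrow> real \<times> 'a \<Rightarrow> real \<times> 'a" where
  "ptrans x y v =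
     (THE w. \<exists>V. parallel_along (\<lambda>t. hexp x (t *\<^sub>R hlog x y)) V \<and> V 0 = v \<and> V 1 = w)"

definition gspan :: "(real \<times> 'a::euclidean_space) set \<Rightarrow> (real \<times> 'a) set" where
  "gspan X = hyp \<inter> span X"

definition g_convex :: "(real \<times> 'a::euclidean_space \<Rightarrow> real) \<Rightarrow> bool" where
  "g_convex f \<longleftrightarrow> (\<forall>x\<in>hyp. \<forall>v\<in>tangent x. convex_on UNIV (\<lambda>t. f (hexp x (t *\<^sub>R v))))"

definition g_lipschitz :: "real \<Rightarrow> (real \<times> 'a::euclidean_space \<Rightarrow> real) \<Rightarrow> bool" where
  "g_lipschitz M f \<longleftrightarrow> (\<forall>x\<in>hyp. \<forall>y\<in>hyp. \<bar>f x - f y\<bar> \<le> M * hdist x y)"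

definition subdiff ::
    "(real \<times> 'a::euclidean_space \<Rightarrow> real) \<Rightarrow> real \<times> 'a \<Rightarrow> (real \<times> 'a) set" where
  "subdiff f x = {g \<in> tangent x. \<forall>y\<in>hyp. f y \<ge> f x + mink g (hlog x y)}"

definition zeta :: "real \<Rightarrow> real" where
  "zeta r = r / tanh r"


section \<open>Oracles and deterministic first-order algorithms\<close>

text \<open>
  The first argument of an oracle is the index of the query; the answer to the same point may
  depend on it. An algorithm maps the list of past triples \<open>(f x\<^sub>l, x\<^sub>l, g\<^sub>l)\<close>, oldest first, to
  the next query.
\<close>

type_synonym 'p oracle_fun = "nat \<Rightarrow> 'p \<Rightarrow> real \<times> 'p"

type_synonym 'p algorithm = "(real \<times> 'p \<times> 'p) list \<Rightarrow> 'p"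

definition is_oracle ::
    "(real \<times> 'a::euclidean_space \<Rightarrow> real) \<Rightarrow> (real \<times> 'a) oracle_fun \<Rightarrow> bool" where
  "is_oracle f Or \<longleftrightarrow>
     (\<forall>k. \<forall>x\<in>hyp. fst (Or k x) = f x \<and> snd (Or k x) \<in> subdiff f x)"

primrec transcript :: "'p algorithm \<Rightarrow> 'p oracle_fun \<Rightarrow> nat \<Rightarrow> (real \<times> 'p \<times> 'p) list" where
  "transcript A Or 0 = []"
| "transcript A Or (Suc k) =
     (let h = transcript A Or k; x = A h in h @ [(fst (Or k x), x, snd (Or k x))])"

definition iterate :: "'p algorithm \<Rightarrow> 'p oracle_fun \<Rightarrow> nat \<Rightarrow> 'p" where
  "iterate A Or k = A (transcript A Or k)"

definition answer_grad :: "'p algorithm \<Rightarrow> 'p oracle_fun \<Rightarrow> nat \<Rightarrow> 'p" where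
  "answer_grad A Or k = snd (Or k (iterate A Or k))"

definition assumption_A1 ::
    "(real \<times> 'a::euclidean_space \<Rightarrow> real) \<Rightarrow> (real \<times> 'a) algorithm \<Rightarrow> bool" where
  "assumption_A1 f A \<longleftrightarrow>
     (\<forall>Or. is_oracle f Or \<longrightarrow>
        iterate A Or 0 = e0 \<and>
        (\<forall>k\<ge>1. iterate A Or k \<in> gspan (iterate A Or ` {..<k} \<union> answer_grad A Or ` {..<k})))"


section \<open>The hard instance\<close>

definition next_shift :: "real \<Rightarrow> real \<Rightarrow> real" where
  "next_shift \<theta> \<rho> = (THE \<delta>. 0 < \<delta> \<and> cos \<theta> = tanh \<delta> / tanh \<rho>)"

definition next_radius :: "real \<Rightarrow> real \<Rightarrow> real" where
  "next_radius \<theta> \<rho> = (THE s. 0 < s \<and> sin \<theta> = sinh s / sinh \<rho>)"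

primrec radius :: "real \<Rightarrow> real \<Rightarrow> nat \<Rightarrow> real" where
  "radius \<theta> r 0 = r"
| "radius \<theta> r (Suc k) = next_radius \<theta> (radius \<theta> r k)"

definition shift :: "real \<Rightarrow> real \<Rightarrow> nat \<Rightarrow> real" where
  "shift \<theta> r k = next_shift \<theta> (radius \<theta> r k)"

text \<open>
  The pair \<open>(y\<^sub>k, i \<mapsto> e\<^sub>i\<^bsup>(k)\<^esup>)\<close>. The function \<open>b\<close> lists the standard basis vectors of \<open>\<real>\<^sup>d\<close> as
  \<open>b 1, \<dots>, b d\<close>; its other values are irrelevant.
\<close>

primrec moving_frame ::
    "real \<Rightarrow> real \<Rightarrow> (nat \<Rightarrow> 'a::euclidean_space) \<Rightarrow> nat \<Rightarrow> (real \<times> 'a) \<times> (nat \<Rightarrow> real \<times> 'a)" where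
  "moving_frame \<theta> r b 0 = (e0, \<lambda>i. (0, b i))"
| "moving_frame \<theta> r b (Suc k) =
     (let y = fst (moving_frame \<theta> r b k);
          e = snd (moving_frame \<theta> r b k);
          y' = hexp y (shift \<theta> r k *\<^sub>R e (Suc k))
      in (y', \<lambda>i. ptrans y y' (e i)))"

definition ypt :: "real \<Rightarrow> real \<Rightarrow> (nat \<Rightarrow> 'a::euclidean_space) \<Rightarrow> nat \<Rightarrow> real \<times> 'a" where
  "ypt \<theta> r b k = fst (moving_frame \<theta> r b k)"

definition evec :: "real \<Rightarrow> real \<Rightarrow> (nat \<Rightarrow> 'a::euclidean_space) \<Rightarrow> nat \<Rightarrow> nat \<Rightarrow> real \<times> 'a" where
  "evec \<theta> r b k i = snd (moving_frame \<theta> r b k) i"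

primrec sphere_set ::
    "real \<Rightarrow> real \<Rightarrow> (nat \<Rightarrow> 'a::euclidean_space) \<Rightarrow> nat \<Rightarrow> (real \<times> 'a) set" where
  "sphere_set \<theta> r b 0 = {x \<in> hyp. hdist x (ypt \<theta> r b 0) = r}"
| "sphere_set \<theta> r b (Suc k) =
     {x \<in> sphere_set \<theta> r b k. hangle (evec \<theta> r b k (Suc k)) (hlog (ypt \<theta> r b k) x) = \<theta>}"

definition subspace_I :: "real \<Rightarrow> real \<Rightarrow> (nat \<Rightarrow> 'a::euclidean_space) \<Rightarrow> nat \<Rightarrow> (real \<times> 'a) set" where
  "subspace_I \<theta> r b k = gspan (ypt \<theta> r b ` {0..k})"

definition normal_V ::
    "real \<Rightarrow> real \<Rightarrow> (nat \<Rightarrow> 'a::euclidean_space) \<Rightarrow> real \<times> 'a \<Rightarrow> nat \<Rightarrow> real \<times> 'a" where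
  "normal_V \<theta> r b xs k =
     (1 / cos \<theta>) *\<^sub>R evec \<theta> r b k (Suc k)
     - (1 / hdist (ypt \<theta> r b k) xs) *\<^sub>R hlog (ypt \<theta> r b k) xs"

definition halfspace_L ::
    "real \<Rightarrow> real \<Rightarrow> (nat \<Rightarrow> 'a::euclidean_space) \<Rightarrow> real \<times> 'a \<Rightarrow> nat \<Rightarrow> (real \<times> 'a) set" where
  "halfspace_L \<theta> r b xs k =
     hexp (ypt \<theta> r b k) ` {v \<in> tangent (ypt \<theta> r b k). mink (normal_V \<theta> r b xs k) v \<ge> 0}"

text \<open>Only meant for \<open>DIM('a) \<ge> 2\<close>, where the index set of the maximum is nonempty.\<close>

definition hard_fun ::
    "real \<Rightarrow> real \<Rightarrow> (nat \<Rightarrow> 'a::euclidean_space) \<Rightarrow> real \<times> 'a \<Rightarrow> real \<times> 'a \<Rightarrow> real" where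
  "hard_fun \<theta> r b xs x =
     hdist x xs +
     (MAX i\<in>{0..DIM('a) - 2}. 1 / cos \<theta> * hdist_set x (halfspace_L \<theta> r b xs i))"

definition hard_grad ::
    "real \<Rightarrow> real \<Rightarrow> (nat \<Rightarrow> 'a::euclidean_space) \<Rightarrow> real \<times> 'a \<Rightarrow> nat \<Rightarrow> real \<times> 'a \<Rightarrow> real \<times> 'a" where
  "hard_grad \<theta> r b xs k x =
     (let \<theta>x = hangle (hlog x (ypt \<theta> r b (Suc k))) (hlog x xs);
          V = normal_V \<theta> r b xs k
      in - ((sin \<theta>x / cos \<theta>) *\<^sub>R ptrans (ypt \<theta> r b k) x ((1 / mnorm V) *\<^sub>R V))
         - (1 / hdist x xs) *\<^sub>R hlog x xs)"

definition is_hard_oracle ::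
    "real \<Rightarrow> real \<Rightarrow> (nat \<Rightarrow> 'a::euclidean_space) \<Rightarrow> real \<times> 'a
     \<Rightarrow> (real \<times> 'a \<Rightarrow> real) \<Rightarrow> (real \<times> 'a) oracle_fun \<Rightarrow> bool" where
  "is_hard_oracle \<theta> r b xs f Or \<longleftrightarrow>
     (\<forall>j. \<forall>x\<in>hyp.
        fst (Or j x) = f x \<and>
        (if j \<le> DIM('a) - 2 \<and>
            x \<in> subspace_I \<theta> r b j \<inter> (\<Inter>l\<in>{0..DIM('a) - 2}. halfspace_L \<theta> r b xs l)
         then snd (Or j x) = hard_grad \<theta> r b xs j x
         else snd (Or j x) \<in> subdiff f x))"

text \<open>
  The half-spaces required at query \<open>k\<close> are those with index \<open>l < k\<close>. The condition is imposed
  for every choice of the subgradients that the hard oracle leaves open.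
\<close>

definition assumption_A2 ::
    "real \<Rightarrow> real \<Rightarrow> (nat \<Rightarrow> 'a::euclidean_space) \<Rightarrow> real \<times> 'a
     \<Rightarrow> (real \<times> 'a \<Rightarrow> real) \<Rightarrow> (real \<times> 'a) algorithm \<Rightarrow> bool" where
  "assumption_A2 \<theta> r b xs f A \<longleftrightarrow>
     (\<forall>Or. is_hard_oracle \<theta> r b xs f Or \<longrightarrow>
        (\<forall>k\<le>DIM('a) - 1. iterate A Or k \<in> (\<Inter>l\<in>{..<k}. halfspace_L \<theta> r b xs l)))"

end

theory Submission
  imports Defs
begin

text \<open>
  All \<open>y\<^sub>k\<close> and walls can be written in the standard basis: \<open>y\<^sub>k\<^sub>+\<^sub>1\<close> is a combination of
  \<open>y\<^sub>k\<close> and \<open>e\<^sub>k\<^sub>+\<^sub>1\<close>, the point \<open>y\<^sub>k\<close> is the projection of \<open>x\<^sup>*\<close> to the subspace \<open>I\<^sub>k\<close>, and the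
  normal \<open>V\<^sub>k\<close> is orthogonal to \<open>I\<^sub>k\<close> and to \<open>x\<^sup>*\<close>. Hence \<open>x\<^sup>*\<close> minimises \<open>f\<close> with value \<open>0\<close>, parallel
  transport fixes the normal along \<open>I\<^sub>k\<close>, and every point of \<open>I\<^sub>k\<close> lies on the walls of all
  half-spaces with index at least \<open>k\<close>, the remaining ones being covered by A2. By the law of sines
  in the right triangle \<open>x, y\<^sub>k\<^sub>+\<^sub>1, x\<^sup>*\<close> the \<open>x\<^sup>*\<close>-components of the two parts of the hard
  subgradient cancel, so each answer reveals one dimension only and \<open>x\<^sub>k \<in> I\<^sub>k\<close>. Therefore
  \<open>f(x\<^sub>k) \<ge> dist(x\<^sub>k, x\<^sup>*) \<ge> r\<^sub>k\<close>, where \<open>sinh r\<^sub>k = (sin \<theta>)\<^sup>k sinh r\<close>, and the choice of \<open>d\<close> gives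
  \<open>r\<^sub>d\<^sub>-\<^sub>1 \<ge> r / 2 = \<epsilon> M r\<close>, since \<open>(sin \<theta>)\<^sup>2 \<ge> exp (- 2 ln 2 (cos \<theta>)\<^sup>2)\<close> by convexity of \<open>exp\<close>. Convexity and the Lipschitz bound follow from the existence of bounded
  subgradients.
\<close>

section \<open>Hyperbolic functions\<close>

text \<open>Convexity of \<open>sinh\<close> on the nonnegative half-line with value 0 at 0,
  obtained by comparing derivatives.\<close>

lemma sinh_scale_le:
  fixes \<beta> \<rho> :: real
  assumes "0 \<le> \<beta>" "\<beta> \<le> 1" "0 \<le> \<rho>"
  shows "sinh (\<beta> * \<rho>) \<le> \<beta> * sinh \<rho>"
proof -
  have "\<beta> * sinh 0 - sinh (\<beta> * 0) \<le> \<beta> * sinh \<rho> - sinh (\<beta> * \<rho>)"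
  proof (rule DERIV_nonneg_imp_nondecreasing[OF assms(3)])
    fix x :: real
    assume x: "0 \<le> x" "x \<le> \<rho>"
    have "((\<lambda>x. \<beta> * sinh x - sinh (\<beta> * x)) has_real_derivative
        \<beta> * (cosh x - cosh (\<beta> * x))) (at x)"
      by (auto intro!: derivative_eq_intros simp: algebra_simps)
    moreover have "cosh (\<beta> * x) \<le> cosh x"
      using assms x by (subst cosh_real_nonneg_le_iff) (auto simp: mult_left_le_one_le)
    ultimately show "\<exists>y. ((\<lambda>x. \<beta> * sinh x - sinh (\<beta> * x)) has_real_derivative y) (at x) \<and> 0 \<le> y"
      using assms by (intro exI[of _ "\<beta> * (cosh x - cosh (\<beta> * x))"]) simp
  qed
  then show ?thesis by simp
qed

text \<open>The concave counterpart: \<open>tanh\<close> grows ever more slowly on the nonnegative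
  half-line and starts at 0.\<close>

lemma tanh_scale_ge:
  fixes \<beta> \<rho> :: real
  assumes "0 \<le> \<beta>" "\<beta> \<le> 1" "0 \<le> \<rho>"
  shows "\<beta> * tanh \<rho> \<le> tanh (\<beta> * \<rho>)"
proof -
  have "tanh (\<beta> * 0) - \<beta> * tanh 0 \<le> tanh (\<beta> * \<rho>) - \<beta> * tanh \<rho>"
  proof (rule DERIV_nonneg_imp_nondecreasing[OF assms(3)])
    fix x :: real
    assume x: "0 \<le> x" "x \<le> \<rho>"
    have "((\<lambda>x. tanh (\<beta> * x) - \<beta> * tanh x) has_real_derivative
        \<beta> * ((tanh x)\<^sup>2 - (tanh (\<beta> * x))\<^sup>2)) (at x)"
      by (auto intro!: derivative_eq_intros simp: algebra_simps)
    moreover have "(tanh (\<beta> * x))\<^sup>2 \<le> (tanh x)\<^sup>2"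
      using assms x by (intro power_mono) (auto simp: mult_left_le_one_le)
    ultimately show "\<exists>y. ((\<lambda>x. tanh (\<beta> * x) - \<beta> * tanh x) has_real_derivative y) (at x) \<and> 0 \<le> y"
      using assms by (intro exI[of _ "\<beta> * ((tanh x)\<^sup>2 - (tanh (\<beta> * x))\<^sup>2)"]) simp
  qed
  then show ?thesis by simp
qed

text \<open>Convexity of \<open>cosh\<close> between \<open>R - \<rho>\<close> and
  \<open>R + \<rho>\<close>. By the law of cosines the right side is \<open>cosh\<close> of a
  triangle side opposite an angle with cosine \<open>\<beta>\<close>, so this is the first-order
  bound behind \<open>hdist_subgradient\<close>.\<close>

lemma cosh_diff_scale_le:
  fixes \<beta> \<rho> R :: real
  assumes "\<bar>\<beta>\<bar> \<le> 1"
  shows "cosh (R - \<rho> * \<beta>) \<le> cosh \<rho> * cosh R - sinh \<rho> * sinh R * \<beta>"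
proof -
  have cvx: "convex_on UNIV (cosh :: real \<Rightarrow> real)"
    by (rule f''_ge0_imp_convex[where f' = sinh and f'' = cosh])
       (auto intro!: derivative_eq_intros)
  have "cosh ((1 - (1 - \<beta>) / 2) *\<^sub>R (R - \<rho>) + ((1 - \<beta>) / 2) *\<^sub>R (R + \<rho>))
      \<le> (1 - (1 - \<beta>) / 2) * cosh (R - \<rho>) + ((1 - \<beta>) / 2) * cosh (R + \<rho>)"
    using assms by (intro convex_onD[OF cvx]) auto
  moreover have "(1 - (1 - \<beta>) / 2) *\<^sub>R (R - \<rho>) + ((1 - \<beta>) / 2) *\<^sub>R (R + \<rho>) = R - \<rho> * \<beta>"
    by (simp add: field_simps)
  moreover have "(1 - (1 - \<beta>) / 2) * cosh (R - \<rho>) + ((1 - \<beta>) / 2) * cosh (R + \<rho>)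
      = cosh \<rho> * cosh R - sinh \<rho> * sinh R * \<beta>"
    by (simp add: cosh_diff cosh_add field_simps)
  ultimately show ?thesis by simp
qed

text \<open>The analogue for the distance to a hyperplane: the right side is \<open>sinh\<close> of
  the signed distance after a move of length \<open>\<rho>\<close> from signed distance
  \<open>q\<close>, where \<open>\<beta>\<close> is the cosine of the angle to the normal.\<close>

lemma sinh_add_scale_le:
  fixes \<beta> \<rho> q :: real
  assumes "\<bar>\<beta>\<bar> \<le> 1" "0 \<le> \<rho>" "0 \<le> q" "0 \<le> q + \<rho> * \<beta>"
  shows "sinh (q + \<rho> * \<beta>) \<le> cosh \<rho> * sinh q + sinh \<rho> * cosh q * \<beta>"
proof (cases "\<beta> \<ge> 0")
  case True
  have "sinh (\<rho> * \<beta>) \<le> \<beta> * sinh \<rho>"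
    using sinh_scale_le[of \<beta> \<rho>] True assms by (simp add: mult.commute)
  then have 1: "cosh q * sinh (\<rho> * \<beta>) \<le> cosh q * (\<beta> * sinh \<rho>)"
    by (rule mult_left_mono) simp
  have "cosh (\<rho> * \<beta>) \<le> cosh \<rho>"
    using assms True by (subst cosh_real_nonneg_le_iff) (auto simp: mult_left_le)
  then have 2: "sinh q * cosh (\<rho> * \<beta>) \<le> sinh q * cosh \<rho>"
    using assms by (intro mult_left_mono) auto
  have "sinh (q + \<rho> * \<beta>) \<le> sinh q * cosh \<rho> + cosh q * (\<beta> * sinh \<rho>)"
    unfolding sinh_add by (rule add_mono[OF 2 1])
  then show ?thesis by (simp only: mult_ac)
next
  case False
  define \<gamma> where "\<gamma> = - \<beta>"
  have \<gamma>: "0 \<le> \<gamma>" "\<gamma> \<le> 1" and \<beta>: "\<beta> = - \<gamma>" using False assms by (auto simp: \<gamma>_def)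
  have qg: "\<gamma> * \<rho> \<le> q" using assms(4) by (simp add: \<beta> mult.commute)
  \<comment> \<open>After division by \<open>cosh q\<close> the claim is monotone in
    \<open>tanh q\<close>, so \<open>q\<close> may be replaced by its least value
    \<open>\<gamma> * \<rho>\<close>; there it reduces to \<open>tanh_scale_ge\<close>.\<close>
  define t where "t = tanh (\<gamma> * \<rho>)"
  have c: "cosh (\<gamma> * \<rho>) \<le> cosh \<rho>"
    using assms \<gamma> by (subst cosh_real_nonneg_le_iff) (auto simp: mult_left_le_one_le)
  have "t * (cosh \<rho> - cosh (\<gamma> * \<rho>)) \<le> tanh q * (cosh \<rho> - cosh (\<gamma> * \<rho>))"
    using c qg by (intro mult_right_mono) (auto simp: t_def)
  moreover have "t * cosh (\<gamma> * \<rho>) = sinh (\<gamma> * \<rho>)" by (simp add: t_def tanh_def)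
  moreover have "\<gamma> * tanh \<rho> * cosh \<rho> \<le> t * cosh \<rho>"
    unfolding t_def using tanh_scale_ge[of \<gamma> \<rho>] \<gamma> assms by (intro mult_right_mono) auto
  moreover have "\<gamma> * tanh \<rho> * cosh \<rho> = \<gamma> * sinh \<rho>" by (simp add: tanh_def)
  ultimately have "0 \<le> (sinh (\<gamma> * \<rho>) - \<gamma> * sinh \<rho>) + tanh q * (cosh \<rho> - cosh (\<gamma> * \<rho>))"
    unfolding right_diff_distrib by linarith
  then have "0 \<le> cosh q * ((sinh (\<gamma> * \<rho>) - \<gamma> * sinh \<rho>) + tanh q * (cosh \<rho> - cosh (\<gamma> * \<rho>)))"
    by simp
  also have "\<dots> = cosh q * (sinh (\<gamma> * \<rho>) - \<gamma> * sinh \<rho>) + sinh q * (cosh \<rho> - cosh (\<gamma> * \<rho>))"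
    by (simp add: tanh_def field_simps)
  finally show ?thesis
    by (simp add: \<beta> sinh_diff algebra_simps)
qed

section \<open>Geometry of the hyperboloid\<close>

lemma mink_simps:
  "mink (x + y) z = mink x z + mink y z"
  "mink x (y + z) = mink x y + mink x z"
  "mink (x - y) z = mink x z - mink y z"
  "mink x (y - z) = mink x y - mink x z"
  "mink (a *\<^sub>R x) y = a * mink x y"
  "mink x (a *\<^sub>R y) = a * mink x y"
  "mink (- x) y = - mink x y"
  "mink x (- y) = - mink x y"
  "mink 0 x = 0" "mink x 0 = 0"
  by (auto simp: mink_def inner_simps algebra_simps)

lemma mink_commute: "mink x y = mink y x"
  by (simp add: mink_def inner_commute mult.commute)

lemma mink_span_eq_0:
  assumes "x \<in> span S" "\<And>y. y \<in> S \<Longrightarrow> mink v y = 0"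
  shows "mink v x = 0"
  using assms(1)
  by (induction rule: span_induct_alt) (auto simp: mink_simps assms(2))

lemma hyp_mink_self: "x \<in> hyp \<Longrightarrow> mink x x = - 1"
  by (simp add: hyp_def)

lemma hyp_fst_pos: "x \<in> hyp \<Longrightarrow> fst x > 0"
  by (simp add: hyp_def mink_def e0_def)

lemma hyp_fst_sq: "x \<in> hyp \<Longrightarrow> (fst x)\<^sup>2 = 1 + (norm (snd x))\<^sup>2"
  by (simp add: hyp_def mink_def dot_square_norm flip: power2_eq_square)

lemma e0_hyp: "e0 \<in> hyp"
  by (simp add: hyp_def mink_def e0_def)

lemma tangent_mink:
  "v \<in> tangent x \<Longrightarrow> mink x v = 0" "v \<in> tangent x \<Longrightarrow> mink v x = 0"
  by (simp_all add: tangent_def mink_commute)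

lemma tangent_closed:
  "u \<in> tangent x \<Longrightarrow> v \<in> tangent x \<Longrightarrow> u + v \<in> tangent x"
  "u \<in> tangent x \<Longrightarrow> v \<in> tangent x \<Longrightarrow> u - v \<in> tangent x"
  "u \<in> tangent x \<Longrightarrow> a *\<^sub>R u \<in> tangent x"
  "0 \<in> tangent x"
  by (simp_all add: tangent_def mink_simps)

text \<open>Tangency and Cauchy-Schwarz bound \<open>fst x * fst v\<close> by the spatial norms. As
  \<open>fst x\<close> exceeds the norm of \<open>snd x\<close>, the first coordinate of
  \<open>v\<close> is strictly dominated by its spatial part.\<close>

lemma tangent_mink_self_pos:
  assumes "x \<in> hyp" "v \<in> tangent x" "v \<noteq> 0"
  shows "0 < mink v v"
proof -
  have eq: "fst x * fst v = snd x \<bullet> snd v"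
    using assms(2) by (simp add: tangent_def mink_def)
  have "(fst x * fst v)\<^sup>2 \<le> (norm (snd x) * norm (snd v))\<^sup>2"
    unfolding eq using Cauchy_Schwarz_ineq2[of "snd x" "snd v"]
    by (metis abs_ge_zero power2_abs power_mono)
  then have le: "(1 + (norm (snd x))\<^sup>2) * (fst v)\<^sup>2 \<le> (norm (snd x))\<^sup>2 * (norm (snd v))\<^sup>2"
    by (simp add: power_mult_distrib hyp_fst_sq[OF assms(1)])
  have sv: "snd v \<noteq> 0"
  proof
    assume "snd v = 0"
    with eq hyp_fst_pos[OF assms(1)] have "fst v = 0" by simp
    with \<open>snd v = 0\<close> assms(3) show False by (simp add: prod_eq_iff)
  qed
  then have "0 < (norm (snd v))\<^sup>2" by simp
  then have "(1 + (norm (snd x))\<^sup>2) * (fst v)\<^sup>2 < (1 + (norm (snd x))\<^sup>2) * (norm (snd v))\<^sup>2"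
    using le unfolding distrib_right by linarith
  then have "(fst v)\<^sup>2 < (norm (snd v))\<^sup>2"
    by (simp add: add_pos_nonneg)
  then show ?thesis
    by (simp add: mink_def dot_square_norm flip: power2_eq_square)
qed

lemma tangent_mink_self_nonneg:
  "x \<in> hyp \<Longrightarrow> v \<in> tangent x \<Longrightarrow> 0 \<le> mink v v"
  using tangent_mink_self_pos[of x v] by (cases "v = 0") (auto simp: mink_simps)

lemma mnorm_nonneg:
  "x \<in> hyp \<Longrightarrow> v \<in> tangent x \<Longrightarrow> 0 \<le> mnorm v"
  by (simp add: mnorm_def tangent_mink_self_nonneg)

lemma mnorm_sq:
  "x \<in> hyp \<Longrightarrow> v \<in> tangent x \<Longrightarrow> mnorm v * mnorm v = mink v v"
  by (simp add: mnorm_def tangent_mink_self_nonneg)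

lemma mnorm_eq_0:
  "x \<in> hyp \<Longrightarrow> v \<in> tangent x \<Longrightarrow> mnorm v = 0 \<longleftrightarrow> v = 0"
  using tangent_mink_self_pos[of x v] by (cases "v = 0") (auto simp: mnorm_def mink_simps)

lemma mnorm_0: "mnorm 0 = 0"
  by (simp add: mnorm_def mink_simps)

lemma mnorm_scaleR: "mnorm (a *\<^sub>R v) = \<bar>a\<bar> * mnorm v"
  by (simp add: mnorm_def mink_simps real_sqrt_mult flip: mult.assoc)

lemma tangent_Cauchy_Schwarz:
  assumes x: "x \<in> hyp" and u: "u \<in> tangent x" and v: "v \<in> tangent x"
  shows "\<bar>mink u v\<bar> \<le> mnorm u * mnorm v"
proof (cases "u = 0")
  case True
  then show ?thesis by (simp add: mink_simps mnorm_def)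
next
  case False
  let ?w = "mink u u *\<^sub>R v - mink u v *\<^sub>R u"
  have pos: "0 < mink u u" using tangent_mink_self_pos[OF x u False] .
  have "0 \<le> mink ?w ?w"
    by (intro tangent_mink_self_nonneg[OF x] tangent_closed u v)
  also have "mink ?w ?w = mink u u * (mink u u * mink v v - (mink u v)\<^sup>2)"
    by (simp add: mink_simps mink_commute[of v u] power2_eq_square algebra_simps)
  finally have "(mink u v)\<^sup>2 \<le> mink u u * mink v v"
    using pos by (simp add: zero_le_mult_iff)
  then have "sqrt ((mink u v)\<^sup>2) \<le> sqrt (mink u u * mink v v)"
    by (rule real_sqrt_le_mono)
  then show ?thesis by (simp add: mnorm_def real_sqrt_mult)
qed

lemma hangle_arg_bounded:
  assumes "x \<in> hyp" "u \<in> tangent x" "v \<in> tangent x"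
  shows "\<bar>mink u v / (mnorm u * mnorm v)\<bar> \<le> 1"
  using tangent_Cauchy_Schwarz[OF assms] mnorm_nonneg[OF assms(1,2)] mnorm_nonneg[OF assms(1,3)]
  by (auto simp: abs_mult divide_le_eq_1)

section \<open>Hyperbolic distance\<close>

lemma hyp_mink_le:
  assumes "x \<in> hyp" "y \<in> hyp"
  shows "1 \<le> - mink x y"
proof -
  have "snd x \<bullet> snd y \<le> norm (snd x) * norm (snd y)"
    by (rule norm_cauchy_schwarz)
  moreover have "(1 + norm (snd x) * norm (snd y))\<^sup>2 \<le> (fst x * fst y)\<^sup>2"
  proof -
    have "(fst x * fst y)\<^sup>2 = (1 + (norm (snd x))\<^sup>2) * (1 + (norm (snd y))\<^sup>2)"
      by (simp add: power_mult_distrib hyp_fst_sq assms)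
    moreover have "(1 + (norm (snd x))\<^sup>2) * (1 + (norm (snd y))\<^sup>2) - (1 + norm (snd x) * norm (snd y))\<^sup>2
        = (norm (snd x) - norm (snd y))\<^sup>2"
      by (simp add: power2_eq_square algebra_simps)
    ultimately show ?thesis
      using zero_le_power2[of "norm (snd x) - norm (snd y)"] by linarith
  qed
  then have "1 + norm (snd x) * norm (snd y) \<le> fst x * fst y"
    by (rule power2_le_imp_le) (simp add: hyp_fst_pos assms less_imp_le)
  ultimately show ?thesis by (simp add: mink_def)
qed

lemma hdist_nonneg: "x \<in> hyp \<Longrightarrow> y \<in> hyp \<Longrightarrow> 0 \<le> hdist x y"
  unfolding hdist_def by (rule arcosh_nonneg_real[OF hyp_mink_le])

lemma cosh_hdist: "x \<in> hyp \<Longrightarrow> y \<in> hyp \<Longrightarrow> cosh (hdist x y) = - mink x y"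
  unfolding hdist_def by (rule cosh_arcosh_real[OF hyp_mink_le])

lemma hdist_commute: "hdist x y = hdist y x"
  by (simp add: hdist_def mink_commute)

lemma hdist_self: "x \<in> hyp \<Longrightarrow> hdist x x = 0"
  by (simp add: hdist_def hyp_mink_self)

text \<open>The difference is a tangent vector of Minkowski square 0, and the form is definite on
  tangent vectors.\<close>

lemma hyp_mink_eq_imp_eq:
  assumes "x \<in> hyp" "y \<in> hyp" "mink x y = - 1"
  shows "x = y"
proof -
  have "y - x \<in> tangent x"
    using assms by (simp add: tangent_def mink_simps hyp_mink_self)
  moreover have "mink (y - x) (y - x) = 0"
    using assms by (simp add: mink_simps hyp_mink_self mink_commute[of y x])
  ultimately show ?thesis using tangent_mink_self_pos[OF assms(1), of "y - x"] by force
qed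

lemma hdist_eq_0_iff:
  "x \<in> hyp \<Longrightarrow> y \<in> hyp \<Longrightarrow> hdist x y = 0 \<longleftrightarrow> x = y"
  using cosh_hdist[of x y] hyp_mink_eq_imp_eq[of x y] by (auto simp: hdist_self)

lemma hyp_memI:
  assumes "mink z z = - 1" "fst z > 0"
  shows "z \<in> hyp"
  using assms by (simp add: hyp_def mink_def e0_def)

section \<open>Exponential map and logarithm\<close>

lemma hexp_mink_self:
  assumes "x \<in> hyp" "v \<in> tangent x"
  shows "mink (hexp x v) (hexp x v) = - 1"
proof (cases "v = 0")
  case True
  then show ?thesis using assms by (simp add: hexp_def mnorm_def mink_simps hyp_mink_self)
next
  case False
  then have m: "mnorm v \<noteq> 0" using mnorm_eq_0[OF assms] by simp
  have "mink (hexp x v) (hexp x v)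
      = - ((cosh (mnorm v))\<^sup>2) + (sinh (mnorm v) / mnorm v)\<^sup>2 * (mnorm v * mnorm v)"
    using assms by (simp add: hexp_def mink_simps hyp_mink_self tangent_mink mnorm_sq power2_eq_square)
  also have "\<dots> = - 1"
    using m by (simp add: power2_eq_square[symmetric] power_divide cosh_square_eq)
  finally show ?thesis .
qed

lemma mink_hexp:
  "mink w (hexp x v) = cosh (mnorm v) * mink w x + sinh (mnorm v) / mnorm v * mink w v"
  by (simp add: hexp_def mink_simps)

lemma hexp_hyp:
  assumes "x \<in> hyp" "v \<in> tangent x"
  shows "hexp x v \<in> hyp"
proof (rule hyp_memI[OF hexp_mink_self[OF assms]])
  let ?z = "hexp x v"
  have "mink x ?z = - cosh (mnorm v)"
    using assms by (simp add: mink_hexp hyp_mink_self tangent_mink)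
  then have "mink x ?z < 0" by simp
  then have lt: "snd x \<bullet> snd ?z < fst x * fst ?z" by (simp add: mink_def)
  have zz: "(fst ?z)\<^sup>2 = 1 + (norm (snd ?z))\<^sup>2"
    using hexp_mink_self[OF assms]
    by (simp add: mink_def dot_square_norm flip: power2_eq_square)
  \<comment> \<open>Only the choice of sheet remains: a point with nonpositive first coordinate
    would lie in the cone opposite to that of \<open>x\<close>, which forces
    \<open>mink x ?z \<ge> 0\<close>.\<close>
  show "fst ?z > 0"
  proof (rule ccontr)
    assume "\<not> fst ?z > 0"
    then have nz: "fst ?z \<le> 0" by simp
    have "norm (snd ?z) < - fst ?z"
    proof (rule power2_less_imp_less)
      show "(norm (snd ?z))\<^sup>2 < (- fst ?z)\<^sup>2" using zz by simp
    qed (use nz in simp)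
    moreover have "norm (snd x) < fst x"
    proof (rule power2_less_imp_less)
      show "(norm (snd x))\<^sup>2 < (fst x)\<^sup>2" using hyp_fst_sq[OF assms(1)] by simp
    qed (simp add: hyp_fst_pos[OF assms(1)] less_imp_le)
    ultimately have "norm (snd x) * norm (snd ?z) \<le> fst x * (- fst ?z)"
      by (intro mult_mono) (auto simp: less_imp_le hyp_fst_pos[OF assms(1)])
    moreover have "- (snd x \<bullet> snd ?z) \<le> norm (snd x) * norm (snd ?z)"
      using Cauchy_Schwarz_ineq2[of "snd x" "snd ?z"] by linarith
    ultimately show False using lt by simp
  qed
qed

lemma hdist_hexp:
  assumes "x \<in> hyp" "v \<in> tangent x"
  shows "hdist x (hexp x v) = mnorm v"
proof -
  have "- mink x (hexp x v) = cosh (mnorm v)"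
    using assms by (simp add: mink_hexp hyp_mink_self tangent_mink)
  then show ?thesis using mnorm_nonneg[OF assms] by (simp add: hdist_def arcosh_cosh_real)
qed

lemma inj_on_hexp:
  assumes "x \<in> hyp"
  shows "inj_on (hexp x) (tangent x)"
proof (rule inj_onI)
  fix u v
  assume u: "u \<in> tangent x" and v: "v \<in> tangent x" and eq: "hexp x u = hexp x v"
  have m: "mnorm u = mnorm v" using hdist_hexp[OF assms u] hdist_hexp[OF assms v] eq by simp
  show "u = v"
  proof (cases "mnorm v = 0")
    case True
    then show ?thesis using m mnorm_eq_0[OF assms u] mnorm_eq_0[OF assms v] by simp
  next
    case False
    have "(sinh (mnorm v) / mnorm v) *\<^sub>R u = (sinh (mnorm v) / mnorm v) *\<^sub>R v"
      using eq m by (simp add: hexp_def)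
    then show ?thesis using False by simp
  qed
qed

text \<open>The logarithm in closed form: the part of \<open>y\<close> orthogonal to
  \<open>x\<close>, rescaled to length \<open>D\<close>. If \<open>x = y\<close>, then
  \<open>D / sinh D\<close> is \<open>0 / 0 = 0\<close>, which gives the correct value
  \<open>v = 0\<close>.\<close>

lemma hexp_log_formula:
  assumes x: "x \<in> hyp" and y: "y \<in> hyp"
  defines "D \<equiv> hdist x y"
  defines "v \<equiv> (D / sinh D) *\<^sub>R (y - cosh D *\<^sub>R x)"
  shows "v \<in> tangent x" "mnorm v = D" "hexp x v = y"
proof -
  have c: "mink x y = - cosh D" "mink y x = - cosh D"
    using cosh_hdist[OF x y] by (simp_all add: D_def mink_commute)
  have D0: "0 \<le> D" unfolding D_def by (rule hdist_nonneg[OF x y])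
  show "v \<in> tangent x"
    by (simp add: v_def tangent_def mink_simps c hyp_mink_self[OF x])
  have "mink (y - cosh D *\<^sub>R x) (y - cosh D *\<^sub>R x) = (sinh D)\<^sup>2"
    by (simp add: mink_simps c hyp_mink_self x y cosh_square_eq[unfolded power2_eq_square] power2_eq_square)
  then have "mnorm (y - cosh D *\<^sub>R x) = sinh D"
    using D0 by (simp add: mnorm_def)
  then show m: "mnorm v = D"
    using D0 by (cases "D = 0") (auto simp: v_def mnorm_scaleR mnorm_0)
  show "hexp x v = y"
  proof (cases "D = 0")
    case True
    then have "x = y" using hdist_eq_0_iff[OF x y] by (simp add: D_def)
    then show ?thesis using True m by (simp add: hexp_def v_def)
  next
    case False
    then show ?thesis unfolding hexp_def m by (simp add: v_def)
  qed
qed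

lemma hlog_hexp:
  "x \<in> hyp \<Longrightarrow> v \<in> tangent x \<Longrightarrow> hlog x (hexp x v) = v"
  by (simp add: hlog_def inv_into_f_f inj_on_hexp)

lemma hlog_eq:
  assumes "x \<in> hyp" "y \<in> hyp"
  shows "hlog x y = (hdist x y / sinh (hdist x y)) *\<^sub>R (y - cosh (hdist x y) *\<^sub>R x)"
  using hlog_hexp[OF assms(1) hexp_log_formula(1)[OF assms]]
  unfolding hexp_log_formula(3)[OF assms] .

lemma hlog_tangent: "x \<in> hyp \<Longrightarrow> y \<in> hyp \<Longrightarrow> hlog x y \<in> tangent x"
  by (simp add: hlog_eq hexp_log_formula)

lemma mnorm_hlog: "x \<in> hyp \<Longrightarrow> y \<in> hyp \<Longrightarrow> mnorm (hlog x y) = hdist x y"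
  by (simp add: hlog_eq hexp_log_formula)

lemma hexp_hlog: "x \<in> hyp \<Longrightarrow> y \<in> hyp \<Longrightarrow> hexp x (hlog x y) = y"
  by (simp add: hlog_eq hexp_log_formula)

text \<open>The sheet can be tested against any point \<open>x\<close> of it: \<open>z\<close> is
  the exponential at \<open>x\<close> of a multiple of its tangential part. This suits
  \<open>hdist_set_halfspace\<close>, where a foot point is built from \<open>x\<close>.\<close>

lemma hyp_mink_neg_imp_mem:
  assumes "x \<in> hyp" "mink z z = - 1" "mink x z < 0"
  shows "z \<in> hyp"
proof -
  define c where "c = - mink x z"
  define w where "w = z - c *\<^sub>R x"
  have wt: "w \<in> tangent x"
    using assms by (simp add: w_def c_def tangent_def mink_simps hyp_mink_self)
  have ww: "mink w w = c\<^sup>2 - 1"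
    using assms by (simp add: w_def c_def mink_simps hyp_mink_self mink_commute[of z x] power2_eq_square)
  then have c1: "1 \<le> c"
    using tangent_mink_self_nonneg[OF assms(1) wt] assms(3)
    by (intro power2_le_imp_le[of 1 c]) (auto simp: c_def)
  define D where "D = arcosh c"
  have cD: "cosh D = c" using c1 by (simp add: D_def)
  have D0: "0 \<le> D" using c1 by (simp add: D_def)
  have sD: "sinh D = mnorm w" using D0 by (simp add: mnorm_def ww cD[symmetric] sinh_square_eq[symmetric])
  have "hexp x ((D / sinh D) *\<^sub>R w) = z"
  proof (cases "D = 0")
    case True
    then have "w = 0" using sD mnorm_eq_0[OF assms(1) wt] by simp
    then show ?thesis using cD True by (simp add: hexp_def mnorm_def mink_simps w_def)
  next
    case False
    then have "mnorm ((D / sinh D) *\<^sub>R w) = D"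
      using D0 by (simp add: mnorm_scaleR sD[symmetric])
    then show ?thesis using False by (simp add: hexp_def cD w_def)
  qed
  then show ?thesis using hexp_hyp[OF assms(1) tangent_closed(3)[OF wt, of "D / sinh D"]] by simp
qed

text \<open>Supplies the product rule for differentiating the Minkowski square of a field.\<close>

lemma bounded_bilinear_mink: "bounded_bilinear mink"
proof -
  have "bounded_linear (\<lambda>y::real \<times> 'a. (- fst y, snd y))"
    by (intro bounded_linear_Pair bounded_linear_minus bounded_linear_fst bounded_linear_snd)
  then have "bounded_bilinear (\<lambda>x y::real \<times> 'a. x \<bullet> (- fst y, snd y))"
    using bounded_bilinear.comp[OF bounded_bilinear_inner bounded_linear_ident] by blast
  moreover have "(\<lambda>x y::real \<times> 'a. x \<bullet> (- fst y, snd y)) = mink"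
    by (auto simp: fun_eq_iff mink_def inner_prod_def)
  ultimately show ?thesis by simp
qed

lemma mink_hlog:
  assumes "x \<in> hyp" "y \<in> hyp"
  shows "mink v (hlog x y)
    = hdist x y / sinh (hdist x y) * (mink v y - cosh (hdist x y) * mink v x)"
  by (simp add: hlog_eq[OF assms] mink_simps)

lemma mnorm_triangle:
  assumes "x \<in> hyp" "u \<in> tangent x" "v \<in> tangent x"
  shows "mnorm (u + v) \<le> mnorm u + mnorm v"
proof -
  have "mnorm (u + v) * mnorm (u + v) = mink (u + v) (u + v)"
    by (intro mnorm_sq[OF assms(1)] tangent_closed assms)
  also have "\<dots> = mnorm u * mnorm u + mnorm v * mnorm v + 2 * mink u v"
    using assms by (simp add: mnorm_sq mink_simps mink_commute[of v u])
  also have "\<dots> \<le> (mnorm u + mnorm v)\<^sup>2"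
    using tangent_Cauchy_Schwarz[OF assms] by (simp add: power2_eq_square algebra_simps)
  finally have "(mnorm (u + v))\<^sup>2 \<le> (mnorm u + mnorm v)\<^sup>2" by (simp add: power2_eq_square)
  then show ?thesis
    by (rule power2_le_imp_le) (intro add_nonneg_nonneg mnorm_nonneg[OF assms(1)] assms)
qed

text \<open>
  A field orthogonal to both end points is orthogonal to the whole geodesic, so the constant
  field is parallel. Uniqueness holds because the difference of two parallel fields has constant
  Minkowski square.
\<close>

lemma ptrans_orthogonal:
  assumes x: "x \<in> hyp" and y: "y \<in> hyp" and vx: "mink v x = 0" and vy: "mink v y = 0"
  shows "ptrans x y v = v"
proof -
  define \<gamma> where "\<gamma> t = hexp x (t *\<^sub>R hlog x y)" for t :: real
  have \<gamma>h: "\<gamma> t \<in> hyp" for t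
    unfolding \<gamma>_def by (intro hexp_hyp[OF x] tangent_closed hlog_tangent x y)
  have v\<gamma>: "mink v (\<gamma> t) = 0" for t
    unfolding \<gamma>_def by (simp add: mink_hexp mink_simps mink_hlog[OF x y] vx vy)
  then have vt: "v \<in> tangent (\<gamma> t)" for t
    by (simp add: tangent_def mink_commute)
  have const: "parallel_along \<gamma> (\<lambda>_. v)"
    unfolding parallel_along_def using vt by (auto intro!: exI[of _ 0])
  have "w = v" if V: "parallel_along \<gamma> V" "V 0 = v" "V 1 = w" for V w
  proof -
    have Vt: "V t \<in> tangent (\<gamma> t)"
      and "\<exists>c. (V has_vector_derivative c *\<^sub>R \<gamma> t) (at t within {0..1})" if "t \<in> {0..1}" for t
      using V(1) that unfolding parallel_along_def by blast+
    then obtain c where c: "\<And>t. t \<in> {0..1} \<Longrightarrow>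
        (V has_vector_derivative c t *\<^sub>R \<gamma> t) (at t within {0..1})"
      by metis
    define q where "q t = mink (V t - v) (V t - v)" for t
    have Dt: "V t - v \<in> tangent (\<gamma> t)" if "t \<in> {0..1}" for t
      by (intro tangent_closed Vt vt that)
    have "(q has_vector_derivative 0) (at t within {0..1})" if t: "t \<in> {0..1}" for t
    proof -
      have "((\<lambda>t. V t - v) has_vector_derivative c t *\<^sub>R \<gamma> t) (at t within {0..1})"
        using has_vector_derivative_diff[OF c[OF t] has_vector_derivative_const[of v]] by simp
      from bounded_bilinear.has_vector_derivative[OF bounded_bilinear_mink this this]
      show ?thesis
        using tangent_mink[OF Dt[OF t]] by (simp add: q_def[abs_def] mink_simps)
    qed
    then obtain k where "\<And>t. t \<in> {0..1} \<Longrightarrow> q t = k"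
      using has_vector_derivative_zero_constant[OF convex_real_interval(5), of 0 1 q] by blast
    then have "q 1 = q 0" by simp
    then have "mink (V 1 - v) (V 1 - v) = 0"
      using V by (simp add: q_def mink_simps)
    then have "V 1 - v = 0"
      using tangent_mink_self_pos[OF \<gamma>h[of 1] Dt[of 1]] by force
    then show ?thesis using V by simp
  qed
  with const show ?thesis
    unfolding ptrans_def \<gamma>_def[symmetric] by (intro the_equality) blast+
qed

text \<open>A geodesic may be restarted at any of its points; the witness \<open>w\<close> is its
  velocity at time \<open>a\<close>, and the identity is the addition theorem for
  \<open>cosh\<close> and \<open>sinh\<close>. This makes subgradients at intermediate points
  usable.\<close>

lemma geodesic_reparam:
  assumes x: "x \<in> hyp" and v: "v \<in> tangent x"
  shows "\<exists>w \<in> tangent (hexp x (a *\<^sub>R v)). \<forall>t. hexp x (t *\<^sub>R v) = hexp (hexp x (a *\<^sub>R v)) ((t - a) *\<^sub>R w)"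
proof (cases "v = 0")
  case True
  then show ?thesis
    by (intro bexI[of _ 0]) (auto simp: hexp_def mnorm_0 tangent_closed)
next
  case False
  define n where "n = mnorm v"
  have n: "n > 0" using mnorm_nonneg[OF x v] mnorm_eq_0[OF x v] False by (simp add: n_def)
  have vv: "mink v v = n * n" using mnorm_sq[OF x v] by (simp add: n_def)
  have hexp_eq: "hexp p (t *\<^sub>R w) = cosh (t * n) *\<^sub>R p + (sinh (t * n) / n) *\<^sub>R w"
    if "mnorm w = n" for p w :: "real \<times> 'a" and t
    using n that by (cases "t \<ge> 0") (auto simp: hexp_def mnorm_scaleR)
  define p where "p = hexp x (a *\<^sub>R v)"
  define w where "w = (n * sinh (a * n)) *\<^sub>R x + cosh (a * n) *\<^sub>R v"
  have p: "p = cosh (a * n) *\<^sub>R x + (sinh (a * n) / n) *\<^sub>R v"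
    unfolding p_def by (rule hexp_eq) (simp add: n_def)
  have xv: "mink x v = 0" "mink v x = 0" by (simp_all add: tangent_mink[OF v])
  have "mink w w = n * n * ((cosh (a * n))\<^sup>2 - (sinh (a * n))\<^sup>2)"
    by (simp add: w_def mink_simps xv vv hyp_mink_self[OF x] power2_eq_square algebra_simps)
  also have "\<dots> = n * n" by (simp add: cosh_square_eq)
  finally have mw: "mnorm w = n" using n by (simp add: mnorm_def)
  have "w \<in> tangent p"
    using n by (simp add: tangent_def w_def p mink_simps xv vv hyp_mink_self[OF x])
  moreover have "hexp x (t *\<^sub>R v) = hexp p ((t - a) *\<^sub>R w)" for t
  proof -
    have "cosh (t * n) = cosh ((t - a) * n + a * n)" "sinh (t * n) = sinh ((t - a) * n + a * n)"
      by (simp_all add: algebra_simps)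
    then have c: "cosh (t * n) = cosh ((t - a) * n) * cosh (a * n) + sinh ((t - a) * n) * sinh (a * n)"
      and s: "sinh (t * n) = sinh ((t - a) * n) * cosh (a * n) + cosh ((t - a) * n) * sinh (a * n)"
      by (simp_all only: cosh_add sinh_add)
    have "hexp x (t *\<^sub>R v) = cosh (t * n) *\<^sub>R x + (sinh (t * n) / n) *\<^sub>R v"
      by (rule hexp_eq) (simp add: n_def)
    also have "\<dots> = cosh ((t - a) * n) *\<^sub>R p + (sinh ((t - a) * n) / n) *\<^sub>R w"
      unfolding c s p w_def using n
      by (simp add: algebra_simps add_divide_distrib)
    also have "\<dots> = hexp p ((t - a) *\<^sub>R w)"
      by (rule hexp_eq[OF mw, symmetric])
    finally show ?thesis .
  qed
  ultimately show ?thesis unfolding p_def by blast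
qed

section \<open>Subgradients\<close>

text \<open>Along a geodesic each subgradient yields a supporting line, and a real function with a
  supporting line at every point is convex.\<close>

lemma g_convex_if_subdiff_nonempty:
  assumes "\<And>x. x \<in> hyp \<Longrightarrow> subdiff f x \<noteq> {}"
  shows "g_convex f"
  unfolding g_convex_def
proof (intro ballI)
  fix x v :: "real \<times> 'a"
  assume x: "x \<in> hyp" and v: "v \<in> tangent x"
  define F where "F t = f (hexp x (t *\<^sub>R v))" for t
  have support: "\<exists>m. \<forall>t. F t \<ge> F a + (t - a) * m" for a
  proof -
    define p where "p = hexp x (a *\<^sub>R v)"
    have p: "p \<in> hyp" unfolding p_def by (intro hexp_hyp x tangent_closed v)
    obtain w where w: "w \<in> tangent p" "\<And>t. hexp x (t *\<^sub>R v) = hexp p ((t - a) *\<^sub>R w)"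
      using geodesic_reparam[OF x v, of a] unfolding p_def by blast
    obtain g where g: "g \<in> subdiff f p" using assms[OF p] by blast
    have "F t \<ge> F a + (t - a) * mink g w" for t
    proof -
      have "hexp p ((t - a) *\<^sub>R w) \<in> hyp" by (intro hexp_hyp p tangent_closed w)
      then have "f (hexp p ((t - a) *\<^sub>R w)) \<ge> f p + mink g (hlog p (hexp p ((t - a) *\<^sub>R w)))"
        using g by (auto simp: subdiff_def)
      then show ?thesis
        unfolding F_def w(2)[of t] p_def[symmetric] hlog_hexp[OF p tangent_closed(3)[OF w(1)]]
        by (simp only: mink_simps)
    qed
    then show ?thesis by blast
  qed
  show "convex_on UNIV (\<lambda>t. f (hexp x (t *\<^sub>R v)))"
    unfolding F_def[symmetric]
  proof (rule convex_onI)
    fix t a b :: real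
    assume t: "0 < t" "t < 1"
    define z where "z = (1 - t) *\<^sub>R a + t *\<^sub>R b"
    obtain m where m: "\<And>s. F s \<ge> F z + (s - z) * m" using support[of z] by blast
    have "(1 - t) * (F z + (a - z) * m) + t * (F z + (b - z) * m) \<le> (1 - t) * F a + t * F b"
      using t m[of a] m[of b] by (intro add_mono mult_left_mono) auto
    also have "(1 - t) * (F z + (a - z) * m) + t * (F z + (b - z) * m) = F z"
      by (simp add: z_def algebra_simps)
    finally show "F ((1 - t) *\<^sub>R a + t *\<^sub>R b) \<le> (1 - t) * F a + t * F b" by (simp add: z_def)
  qed simp
qed

lemma g_lipschitz_if_bounded_subgradients:
  assumes "\<And>x. x \<in> hyp \<Longrightarrow> \<exists>g \<in> subdiff f x. mnorm g \<le> M"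
  shows "g_lipschitz M f"
proof -
  have "f x - f y \<le> M * hdist x y" if x: "x \<in> hyp" and y: "y \<in> hyp" for x y
  proof -
    obtain g where g: "g \<in> subdiff f x" "mnorm g \<le> M" using assms[OF x] by blast
    then have gt: "g \<in> tangent x" by (simp add: subdiff_def)
    have "f x - f y \<le> \<bar>mink g (hlog x y)\<bar>" using g y by (auto simp: subdiff_def)
    also have "\<dots> \<le> mnorm g * hdist x y"
      using tangent_Cauchy_Schwarz[OF x gt hlog_tangent[OF x y]] by (simp add: mnorm_hlog x y)
    also have "\<dots> \<le> M * hdist x y"
      by (intro mult_right_mono g hdist_nonneg x y)
    finally show ?thesis .
  qed
  then show ?thesis
    unfolding g_lipschitz_def by (auto simp: abs_le_iff) (metis hdist_commute)
qed

text \<open>The hyperbolic law of cosines with apex \<open>x\<close>. A zero side is covered, since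
  its \<open>sinh\<close> factor vanishes.\<close>

lemma mink_hexp_hexp:
  assumes "x \<in> hyp" "u \<in> tangent x" "w \<in> tangent x"
  shows "- mink (hexp x u) (hexp x w)
    = cosh (mnorm u) * cosh (mnorm w) - sinh (mnorm u) * sinh (mnorm w) * (mink u w / (mnorm u * mnorm w))"
  using assms by (simp add: hexp_def mink_simps hyp_mink_self tangent_mink mult_ac)

text \<open>Combines the law of cosines with \<open>cosh_diff_scale_le\<close>. For
  \<open>x = z\<close> the factor \<open>1 / 0 = 0\<close> turns the candidate into the zero
  vector.\<close>

lemma hdist_subgradient:
  assumes x: "x \<in> hyp" and y: "y \<in> hyp" and z: "z \<in> hyp"
  shows "hdist x z + mink (- (1 / hdist x z) *\<^sub>R hlog x z) (hlog x y) \<le> hdist y z"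
proof -
  define u where "u = hlog x y"
  define w where "w = hlog x z"
  have u: "u \<in> tangent x" "mnorm u = hdist x y" "y = hexp x u"
    and w: "w \<in> tangent x" "mnorm w = hdist x z" "z = hexp x w"
    using x y z by (simp_all add: u_def w_def hlog_tangent mnorm_hlog hexp_hlog)
  define \<beta> where "\<beta> = mink u w / (mnorm u * mnorm w)"
  have b: "\<bar>\<beta>\<bar> \<le> 1" unfolding \<beta>_def by (rule hangle_arg_bounded[OF x u(1) w(1)])
  have eq: "mink (- (1 / hdist x z) *\<^sub>R w) u = - (mnorm u * \<beta>)"
    using mnorm_eq_0[OF x u(1)]
    by (auto simp: \<beta>_def mink_simps w(2)[symmetric] mink_commute[of w u])
  have "cosh (mnorm w - mnorm u * \<beta>) \<le> cosh (hdist y z)"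
    using cosh_diff_scale_le[OF b, of "mnorm w" "mnorm u"] cosh_hdist[OF y z]
      mink_hexp_hexp[OF x u(1) w(1)] by (simp add: \<beta>_def u(3)[symmetric] w(3)[symmetric])
  \<comment> \<open>The difference may be negative, while \<open>cosh\<close> reflects the order
    only between nonnegative numbers.\<close>
  then have "cosh \<bar>mnorm w - mnorm u * \<beta>\<bar> \<le> cosh (hdist y z)" by simp
  then have "\<bar>mnorm w - mnorm u * \<beta>\<bar> \<le> hdist y z"
    using hdist_nonneg[OF y z] by (subst (asm) cosh_real_nonneg_le_iff) auto
  then show ?thesis using eq by (simp add: u_def[symmetric] w_def[symmetric] w(2))
qed

text \<open>
  For a unit spacelike \<open>V\<close> this is the distance to the half-space of all \<open>y\<close> with
  \<open>\<langle>V, y\<rangle> \<ge> 0\<close>; see \<open>hdist_set_halfspace\<close> below.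
\<close>

definition wall_dist :: "real \<times> 'a::euclidean_space \<Rightarrow> real \<times> 'a \<Rightarrow> real" where
  "wall_dist V x = arsinh (max 0 (- mink V x))"

lemma wall_dist_nonneg: "0 \<le> wall_dist V x"
  by (simp add: wall_dist_def not_less[symmetric] del: arsinh_less_iff_real)

lemma wall_dist_eq_0: "mink V x \<ge> 0 \<Longrightarrow> wall_dist V x = 0"
  by (simp add: wall_dist_def)

lemma arsinh_real_le_iff: "arsinh x \<le> arsinh y \<longleftrightarrow> x \<le> (y::real)"
  by (simp add: not_less[symmetric])

lemma tangent_projection:
  assumes x: "x \<in> hyp" and V: "mink V V = 1"
  shows "V + mink V x *\<^sub>R x \<in> tangent x"
    and "mnorm (V + mink V x *\<^sub>R x) = sqrt (1 + (mink V x)\<^sup>2)"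
  using assms
  by (auto simp: tangent_def mnorm_def mink_simps mink_commute[of x V] hyp_mink_self
      power2_eq_square)

text \<open>The candidate is minus the unit tangential part of \<open>V\<close>, which points away
  from the half-space. The exponential formula gives \<open>- mink V y\<close> in exactly the form
  bounded by \<open>sinh_add_scale_le\<close>.\<close>

lemma wall_dist_subgradient:
  assumes x: "x \<in> hyp" and y: "y \<in> hyp" and V: "mink V V = 1" and neg: "mink V x \<le> 0"
  shows "wall_dist V x
      + mink (- (1 / sqrt (1 + (mink V x)\<^sup>2)) *\<^sub>R (V + mink V x *\<^sub>R x)) (hlog x y)
    \<le> wall_dist V y"
proof -
  define q where "q = wall_dist V x"
  have sq: "sinh q = - mink V x" and q0: "0 \<le> q"
    using neg wall_dist_nonneg[of V x] by (auto simp: q_def wall_dist_def)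
  have cq: "cosh q = sqrt (1 + (mink V x)\<^sup>2)"
    using neg by (simp add: q_def wall_dist_def cosh_arsinh_real add.commute)
  define W where "W = V + mink V x *\<^sub>R x"
  have W: "W \<in> tangent x" "mnorm W = cosh q"
    using tangent_projection[OF x V] by (simp_all add: W_def cq)
  define u where "u = hlog x y"
  have u: "u \<in> tangent x" "mnorm u = hdist x y" "y = hexp x u"
    using x y by (simp_all add: u_def hlog_tangent mnorm_hlog hexp_hlog)
  define \<beta> where "\<beta> = - (mink W u / (mnorm W * mnorm u))"
  have b: "\<bar>\<beta>\<bar> \<le> 1" unfolding \<beta>_def using hangle_arg_bounded[OF x W(1) u(1)] by simp
  have Wu: "mink W u = - (cosh q * (mnorm u * \<beta>))"
    using mnorm_eq_0[OF x u(1)] by (auto simp: \<beta>_def W(2) mink_simps)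
  then have eq: "mink (- (1 / sqrt (1 + (mink V x)\<^sup>2)) *\<^sub>R W) u = mnorm u * \<beta>"
    by (simp add: mink_simps cq[symmetric])
  have "mink V u = mink W u"
    using tangent_mink[OF u(1)] by (simp add: W_def mink_simps)
  then have Vy: "- mink V y = cosh (mnorm u) * sinh q + sinh (mnorm u) * cosh q * \<beta>"
    using mnorm_eq_0[OF x u(1)] Wu
    by (cases "mnorm u = 0") (simp_all add: u(3) mink_hexp sq)
  have "q + mnorm u * \<beta> \<le> wall_dist V y"
  \<comment> \<open>A negative lower bound is trivial because \<open>wall_dist\<close> is
    nonnegative.\<close>
  proof (cases "0 \<le> q + mnorm u * \<beta>")
    case True
    have "sinh (q + mnorm u * \<beta>) \<le> - mink V y"
      unfolding Vy using sinh_add_scale_le[OF b mnorm_nonneg[OF x u(1)] q0 True] by simp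
    also have "\<dots> \<le> max 0 (- mink V y)" by simp
    finally have "arsinh (sinh (q + mnorm u * \<beta>)) \<le> wall_dist V y"
      unfolding wall_dist_def by (simp only: arsinh_real_le_iff)
    then show ?thesis by (simp add: arsinh_sinh_real)
  next
    case False
    then show ?thesis using wall_dist_nonneg[of V y] by simp
  qed
  then show ?thesis using eq by (simp add: q_def[symmetric] W_def[symmetric] u_def[symmetric])
qed

text \<open>On the wall both \<open>0\<close> and \<open>- V\<close> are subgradients, hence so is
  every vector between them. The hard subgradient uses this with the sine of an angle as
  \<open>s\<close>.\<close>

lemma wall_dist_boundary_subgradient:
  assumes "x \<in> hyp" "y \<in> hyp" "mink V V = 1" "mink V x = 0" "0 \<le> s" "s \<le> 1"
  shows "- (s * mink V (hlog x y)) \<le> wall_dist V y"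
proof -
  have "- mink V (hlog x y) \<le> wall_dist V y"
    using wall_dist_subgradient[of x y V] assms by (simp add: wall_dist_eq_0 mink_simps)
  then have "s * - mink V (hlog x y) \<le> s * wall_dist V y"
    using assms by (intro mult_left_mono)
  also have "\<dots> \<le> wall_dist V y"
    using assms wall_dist_nonneg[of V y] by (simp add: mult_left_le_one_le)
  finally show ?thesis by simp
qed

lemma wall_dist_subdiff:
  assumes x: "x \<in> hyp" and V: "mink V V = 1"
  shows "\<exists>g \<in> subdiff (wall_dist V) x. mnorm g \<le> 1"
proof (cases "mink V x \<le> 0")
  case True
  let ?n = "sqrt (1 + (mink V x)\<^sup>2)"
  have n: "?n > 0" by (simp add: add_pos_nonneg)
  show ?thesis
  proof (rule bexI[where x = "- (1 / ?n) *\<^sub>R (V + mink V x *\<^sub>R x)"])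
    show "mnorm (- (1 / ?n) *\<^sub>R (V + mink V x *\<^sub>R x)) \<le> 1"
      unfolding mnorm_scaleR tangent_projection(2)[OF x V] using n by simp
    show "- (1 / ?n) *\<^sub>R (V + mink V x *\<^sub>R x) \<in> subdiff (wall_dist V) x"
      unfolding subdiff_def using wall_dist_subgradient[OF x _ V True]
        tangent_closed(3)[OF tangent_projection(1)[OF x V]] by blast
  qed
next
  case False
  then show ?thesis
    by (intro bexI[where x = 0])
       (auto simp: subdiff_def tangent_closed mnorm_0 mink_simps wall_dist_eq_0 wall_dist_nonneg)
qed

lemma hdist_subdiff:
  assumes x: "x \<in> hyp" and z: "z \<in> hyp"
  shows "\<exists>g \<in> subdiff (\<lambda>y. hdist y z) x. mnorm g \<le> 1"
proof (rule bexI[where x = "- (1 / hdist x z) *\<^sub>R hlog x z"])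
  show "mnorm (- (1 / hdist x z) *\<^sub>R hlog x z) \<le> 1"
    using hdist_nonneg[OF x z] by (simp only: mnorm_scaleR mnorm_hlog[OF x z]) simp
  show "- (1 / hdist x z) *\<^sub>R hlog x z \<in> subdiff (\<lambda>y. hdist y z) x"
    unfolding subdiff_def using hdist_subgradient[OF x _ z]
      tangent_closed(3)[OF hlog_tangent[OF x z]] by blast
qed

lemma hdist_set_halfspace:
  assumes x: "x \<in> hyp" and V: "mink V V = 1"
  shows "hdist_set x {y \<in> hyp. mink V y \<ge> 0} = wall_dist V x"
  unfolding hdist_set_def
proof (rule cInf_eq_minimum)
  define p where "p = max 0 (- mink V x)"
  \<comment> \<open>The foot point of \<open>x\<close>: adding \<open>p *\<^sub>R V\<close> removes
    a negative \<open>V\<close>-component, and the factor returns to the hyperboloid. Inside the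
    half-space \<open>p = 0\<close> and \<open>z = x\<close>.\<close>
  define z where "z = (1 / sqrt (1 + p\<^sup>2)) *\<^sub>R (x + p *\<^sub>R V)"
  have n: "sqrt (1 + p\<^sup>2) > 0" "(sqrt (1 + p\<^sup>2))\<^sup>2 = 1 + p\<^sup>2" by (simp_all add: add_pos_nonneg)
  have pV: "p * mink V x = - (p\<^sup>2)" "p + mink V x \<ge> 0"
    by (auto simp: p_def max_def power2_eq_square)
  have "mink z z = (1 / (sqrt (1 + p\<^sup>2))\<^sup>2) * (- 1 + 2 * (p * mink V x) + p\<^sup>2)"
    by (simp add: z_def mink_simps hyp_mink_self[OF x] V mink_commute[of x V]
        power2_eq_square algebra_simps)
  also have "\<dots> = - 1"
    unfolding pV n(2) by (simp add: field_simps add_pos_nonneg less_imp_neq[symmetric])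
  finally have zz: "mink z z = - 1" .
  have "mink x z = - ((1 + p\<^sup>2) / sqrt (1 + p\<^sup>2))"
    using pV(1) by (simp add: z_def mink_simps hyp_mink_self[OF x] mink_commute[of x V] divide_simps)
  also have "\<dots> = - sqrt (1 + p\<^sup>2)" by (simp add: real_div_sqrt)
  finally have xz: "mink x z = - sqrt (1 + p\<^sup>2)" .
  have zh: "z \<in> hyp"
    by (rule hyp_mink_neg_imp_mem[OF x zz]) (use xz n in simp)
  have "mink V z \<ge> 0"
    using n pV(2) by (simp add: z_def mink_simps V add.commute)
  moreover have "hdist x z = wall_dist V x"
  proof -
    have "cosh (wall_dist V x) = sqrt (1 + p\<^sup>2)"
      by (simp add: wall_dist_def p_def cosh_arsinh_real add.commute)
    then show ?thesis
      using wall_dist_nonneg[of V x] by (simp add: hdist_def xz arcosh_cosh_real flip: \<open>cosh _ = _\<close>)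
  qed
  ultimately show "wall_dist V x \<in> hdist x ` {y \<in> hyp. mink V y \<ge> 0}"
    using zh by (auto intro!: image_eqI[of _ _ z])
next
  fix d assume "d \<in> hdist x ` {y \<in> hyp. mink V y \<ge> 0}"
  then obtain y where y: "y \<in> hyp" "mink V y \<ge> 0" and d: "d = hdist x y" by blast
  \<comment> \<open>For the lower bound, \<open>wall_dist V\<close> is 1-Lipschitz and vanishes on
    the half-space.\<close>
  have "g_lipschitz 1 (wall_dist V)"
    by (intro g_lipschitz_if_bounded_subgradients wall_dist_subdiff V)
  then have "wall_dist V x - wall_dist V y \<le> 1 * hdist x y"
    using x y(1) unfolding g_lipschitz_def by (metis abs_le_D1)
  then show "wall_dist V x \<le> d" using y by (simp add: d wall_dist_eq_0)
qed

text \<open>As \<open>V\<close> is orthogonal to \<open>y\<close>, the exponential map and the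
  logarithm at \<open>y\<close> only rescale the \<open>V\<close>-component by a nonnegative factor.
  Half-spaces thus become linear inequalities.\<close>

lemma hexp_image_halfspace:
  assumes y: "y \<in> hyp" and V: "mink V y = 0"
  shows "hexp y ` {v \<in> tangent y. mink V v \<ge> 0} = {x \<in> hyp. mink V x \<ge> 0}"
proof (intro equalityI subsetI)
  fix x assume "x \<in> hexp y ` {v \<in> tangent y. mink V v \<ge> 0}"
  then obtain v where v: "v \<in> tangent y" "mink V v \<ge> 0" and x: "x = hexp y v" by blast
  then show "x \<in> {x \<in> hyp. mink V x \<ge> 0}"
    using mnorm_nonneg[OF y v(1)] by (simp add: hexp_hyp[OF y] mink_hexp V)
next
  fix x assume "x \<in> {x \<in> hyp. mink V x \<ge> 0}"
  then have x: "x \<in> hyp" "mink V x \<ge> 0" by auto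
  have "mink V (hlog y x) \<ge> 0"
    using x hdist_nonneg[OF y x(1)] by (simp add: mink_hlog[OF y x(1)] V)
  then show "x \<in> hexp y ` {v \<in> tangent y. mink V v \<ge> 0}"
    using hexp_hlog[OF y x(1)] hlog_tangent[OF y x(1)]
    by (intro image_eqI[of _ _ "hlog y x"]) auto
qed

section \<open>The recursion for radii and shifts\<close>

lemma zeta_le:
  assumes "r > 0"
  shows "zeta r \<le> 1 + r"
proof -
  \<comment> \<open>Written with exponentials, \<open>r * cosh r \<le> (1 + r) * sinh r\<close> is
    this inequality times \<open>exp (- r)\<close>.\<close>
  have "1 + 2 * r \<le> exp (2 * r)" by (rule exp_ge_add_one_self)
  then have "(1 + 2 * r) * exp (- r) \<le> exp (2 * r) * exp (- r)" by (intro mult_right_mono) auto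
  also have "exp (2 * r) * exp (- r) = exp r" by (simp flip: exp_add)
  finally have "r * cosh r \<le> (1 + r) * sinh r"
    by (simp add: cosh_def sinh_def field_simps)
  then show ?thesis using assms by (simp add: zeta_def tanh_def field_simps)
qed

text \<open>After squaring and dropping \<open>exp (- r)\<close> on the right, it suffices that
  \<open>2 * exp (ln 2 * r) \<le> exp r + 2\<close>. The bound \<open>ln 2 \<le> 3 / 4\<close> turns
  this into a polynomial inequality in \<open>z = exp (r / 4)\<close>.\<close>

lemma exp_half_ln2_le_cosh:
  assumes "r > 0"
  shows "exp (ln 2 * (1 + r) / 2) \<le> 2 * cosh (r / 2 :: real)"
proof (rule power2_le_imp_le)
  define z where "z = exp (r / 4)"
  have z: "z > 0" by (simp add: z_def)
  have z3: "z ^ 3 = exp (3 / 4 * r)" and z4: "z ^ 4 = exp r"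
    by (simp_all add: z_def exp_of_nat_mult[symmetric])
  \<comment> \<open>An explicit sum-of-squares certificate for
    \<open>z ^ 4 - 2 * z ^ 3 + 2\<close>.\<close>
  have "0 \<le> (z\<^sup>2 - z - 7/10)\<^sup>2 + 4/10 * (z - 7/4)\<^sup>2 + 57/200" by simp
  also have "\<dots> = z ^ 4 - 2 * z ^ 3 + 2"
    by (simp add: power2_eq_square power3_eq_cube power4_eq_xxxx algebra_simps)
  finally have poly: "2 * z ^ 3 \<le> z ^ 4 + 2" by simp
  have "ln 2 * r \<le> 3 / 4 * r"
    using assms ln2_le_25_over_36 by (intro mult_right_mono) auto
  then have "exp (ln 2 * r) \<le> z ^ 3" by (simp add: z3)
  then have "2 * exp (ln 2 * r) \<le> exp r + 2" using poly by (simp add: z4)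
  also have "\<dots> \<le> (2 * cosh (r / 2))\<^sup>2"
    by (simp add: cosh_def power2_eq_square field_simps flip: exp_add)
  finally have "2 * exp (ln 2 * r) \<le> (2 * cosh (r / 2))\<^sup>2" .
  moreover have "(exp (ln 2 * (1 + r) / 2))\<^sup>2 = 2 * exp (ln 2 * r)"
  proof -
    have "2 * (ln 2 * (1 + r) / 2) = ln 2 + ln 2 * r" by (simp add: distrib_left)
    then have "(exp (ln 2 * (1 + r) / 2))\<^sup>2 = exp (ln 2 + ln 2 * r)"
      by (simp only: exp_double[symmetric])
    then show ?thesis by (simp add: exp_add)
  qed
  ultimately show "(exp (ln 2 * (1 + r) / 2))\<^sup>2 \<le> (2 * cosh (r / 2))\<^sup>2" by simp
qed simp

text \<open>The right side is the chord of \<open>exp\<close> over the interval from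
  \<open>- ln 2\<close> to 0, where \<open>exp\<close> takes the values 1/2 and 1.\<close>

lemma exp_le_one_minus:
  fixes u :: real
  assumes "0 \<le> u" "u \<le> 1 / 2"
  shows "exp (- (2 * ln 2 * u)) \<le> 1 - u"
proof -
  have "exp ((1 - 2 * u) *\<^sub>R 0 + (2 * u) *\<^sub>R (- ln 2)) \<le> (1 - 2 * u) * exp 0 + 2 * u * exp (- ln 2 :: real)"
    using assms by (intro convex_onD[OF exp_convex]) auto
  then show ?thesis by (simp add: exp_minus algebra_simps)
qed

text \<open>The power of the sine is at least \<open>exp (- (ln 2 * (1 + r) / 2))\<close>, hence at
  least \<open>1 / (2 * cosh (r / 2))\<close>; the doubling formula for \<open>sinh r\<close> does
  the rest.\<close>

lemma sin_power_lower_bound: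
  assumes r: "r > 0" and \<theta>: "0 < \<theta>" "\<theta> < pi / 2" and c: "(cos \<theta>)\<^sup>2 \<le> 1 / 2"
    and n: "real n * (cos \<theta>)\<^sup>2 \<le> zeta r / 2"
  shows "sinh (r / 2) \<le> sin \<theta> ^ n * sinh r"
proof -
  have s: "sin \<theta> > 0" using \<theta> by (intro sin_gt_zero) auto
  have "(exp (- (ln 2 * (cos \<theta>)\<^sup>2)))\<^sup>2 \<le> (sin \<theta>)\<^sup>2"
    using exp_le_one_minus[of "(cos \<theta>)\<^sup>2"] c
    by (simp add: exp_double[symmetric] sin_squared_eq mult.assoc)
  then have "exp (- (ln 2 * (cos \<theta>)\<^sup>2)) \<le> sin \<theta>"
    using s by (intro power2_le_imp_le[of "exp (- (ln 2 * (cos \<theta>)\<^sup>2))"]) auto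
  then have "exp (- (ln 2 * (cos \<theta>)\<^sup>2)) ^ n \<le> sin \<theta> ^ n"
    by (intro power_mono) auto
  also have "exp (- (ln 2 * (cos \<theta>)\<^sup>2)) ^ n = exp (- (ln 2 * (real n * (cos \<theta>)\<^sup>2)))"
    by (simp add: exp_of_nat_mult[symmetric] mult_ac)
  finally have 1: "exp (- (ln 2 * (real n * (cos \<theta>)\<^sup>2))) \<le> sin \<theta> ^ n" .
  have "ln 2 * (real n * (cos \<theta>)\<^sup>2) \<le> ln 2 * ((1 + r) / 2)"
    using n zeta_le[OF r] by (intro mult_left_mono) auto
  then have "exp (- (ln 2 * (1 + r) / 2)) \<le> exp (- (ln 2 * (real n * (cos \<theta>)\<^sup>2)))" by simp
  with 1 have 2: "exp (- (ln 2 * (1 + r) / 2)) \<le> sin \<theta> ^ n" by linarith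
  have "1 = exp (- (ln 2 * (1 + r) / 2)) * exp (ln 2 * (1 + r) / 2)"
    by (simp flip: exp_add)
  also have "\<dots> \<le> sin \<theta> ^ n * (2 * cosh (r / 2))"
    using 2 exp_half_ln2_le_cosh[OF r] s by (intro mult_mono) auto
  finally have "sinh (r / 2) * 1 \<le> sinh (r / 2) * (sin \<theta> ^ n * (2 * cosh (r / 2)))"
    using r by (intro mult_left_mono) auto
  also have "\<dots> = sin \<theta> ^ n * sinh (2 * (r / 2))" by (simp only: sinh_double mult_ac)
  finally show ?thesis by simp
qed

section \<open>Solving the equations that define radius and shift\<close>

lemma sinh_next_radius:
  assumes "0 < \<theta>" "\<theta> < pi / 2" "\<rho> > 0"
  shows "next_radius \<theta> \<rho> > 0" "sinh (next_radius \<theta> \<rho>) = sin \<theta> * sinh \<rho>"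
proof -
  have s: "sin \<theta> > 0" using assms by (intro sin_gt_zero) auto
  have "next_radius \<theta> \<rho> = arsinh (sin \<theta> * sinh \<rho>)"
    unfolding next_radius_def
    using s assms by (intro the_equality) (auto simp: field_simps arsinh_sinh_real)
  then show "next_radius \<theta> \<rho> > 0" "sinh (next_radius \<theta> \<rho>) = sin \<theta> * sinh \<rho>"
    using s assms by auto
qed

lemma tanh_next_shift:
  assumes "0 < \<theta>" "\<theta> < pi / 2" "\<rho> > 0"
  shows "next_shift \<theta> \<rho> > 0" "tanh (next_shift \<theta> \<rho>) = cos \<theta> * tanh \<rho>"
proof -
  have c: "cos \<theta> > 0" using assms by (intro cos_gt_zero) auto
  define t where "t = cos \<theta> * tanh \<rho>"
  have t0: "t > 0" using c assms by (simp add: t_def)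
  have "t \<le> 1 * tanh \<rho>" unfolding t_def using assms by (intro mult_right_mono) auto
  then have t1: "t < 1" using tanh_real_lt_1[of \<rho>] by simp
  \<comment> \<open>This is \<open>artanh t\<close>, written so that its sign and its
    \<open>cosh\<close> can be read off.\<close>
  define \<delta> where "\<delta> = arsinh (t / sqrt (1 - t\<^sup>2))"
  have n: "1 - t\<^sup>2 > 0" using t0 t1 by (simp add: abs_square_less_1)
  have "(t / sqrt (1 - t\<^sup>2))\<^sup>2 + 1 = 1 / (1 - t\<^sup>2)"
    using n by (simp add: power_divide field_simps)
  then have "cosh \<delta> = 1 / sqrt (1 - t\<^sup>2)"
    unfolding \<delta>_def cosh_arsinh_real by (simp add: real_sqrt_divide)
  then have td: "tanh \<delta> = t" using n by (simp add: tanh_def \<delta>_def)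
  have d0: "\<delta> > 0" using t0 n by (simp add: \<delta>_def)
  have "next_shift \<theta> \<rho> = \<delta>"
    unfolding next_shift_def
  proof (rule the_equality)
    show "0 < \<delta> \<and> cos \<theta> = tanh \<delta> / tanh \<rho>" using d0 assms by (simp add: td t_def)
    fix e assume "0 < e \<and> cos \<theta> = tanh e / tanh \<rho>"
    then have "tanh e = tanh \<delta>" using assms by (simp add: td t_def)
    then show "e = \<delta>" by (metis artanh_tanh_real)
  qed
  then show "next_shift \<theta> \<rho> > 0" "tanh (next_shift \<theta> \<rho>) = cos \<theta> * tanh \<rho>"
    using d0 td by (auto simp: t_def)
qed

section \<open>The hard instance\<close>

locale hard_instance =
  fixes \<theta> r :: real and b :: "nat \<Rightarrow> 'a::euclidean_space" and xs :: "real \<times> 'a"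
  assumes r_pos: "r > 0" and theta: "0 < \<theta>" "\<theta> < pi / 2"
    and dim: "DIM('a) \<ge> 2" and bij: "bij_betw b {1..DIM('a)} Basis"
    and xs_sphere: "xs \<in> sphere_set \<theta> r b (DIM('a) - 1)"
begin

abbreviation "c \<equiv> cos \<theta>"
abbreviation "s \<equiv> sin \<theta>"
abbreviation "rad \<equiv> radius \<theta> r"
abbreviation "\<Delta> \<equiv> shift \<theta> r"
abbreviation "y \<equiv> ypt \<theta> r b"

definition E :: "nat \<Rightarrow> real \<times> 'a" where "E i = (0, b i)"

lemma c_pos: "c > 0" and s_pos: "s > 0"
  using theta by (auto intro!: cos_gt_zero sin_gt_zero)

lemma rad_pos: "rad k > 0"
  by (induction k) (simp_all add: r_pos sinh_next_radius[OF theta])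

lemma sinh_rad_Suc: "sinh (rad (Suc k)) = s * sinh (rad k)"
  by (simp add: sinh_next_radius[OF theta] rad_pos)

lemma sinh_rad: "sinh (rad k) = s ^ k * sinh r"
  by (induction k) (simp_all add: sinh_rad_Suc del: radius.simps(2))

lemma shift_pos: "\<Delta> k > 0" and tanh_shift: "tanh (\<Delta> k) = c * tanh (rad k)"
  by (simp_all add: shift_def tanh_next_shift[OF theta] rad_pos)

lemma sinh_shift: "sinh (\<Delta> k) = c * tanh (rad k) * cosh (\<Delta> k)"
  unfolding tanh_shift[symmetric] by (simp add: tanh_def)

text \<open>Pythagoras for the right triangle with vertices \<open>y k\<close>,
  \<open>y (Suc k)\<close>, \<open>xs\<close>, derived here from the recursions alone.\<close>

lemma cosh_rad_shift: "cosh (rad (Suc k)) * cosh (\<Delta> k) = cosh (rad k)"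
proof (rule power2_eq_imp_eq)
  have "(cosh (\<Delta> k))\<^sup>2 * (1 - (tanh (\<Delta> k))\<^sup>2) = 1"
  proof -
    have "(cosh (\<Delta> k))\<^sup>2 * (tanh (\<Delta> k))\<^sup>2 = (sinh (\<Delta> k))\<^sup>2"
      by (simp add: tanh_def power_divide del: cosh_square_eq)
    then show ?thesis using cosh_square_eq[of "\<Delta> k"] by (simp add: right_diff_distrib)
  qed
  moreover have "(cosh (rad k))\<^sup>2 * (1 - (tanh (\<Delta> k))\<^sup>2) = (cosh (rad (Suc k)))\<^sup>2"
  proof -
    have "(cosh (rad k))\<^sup>2 * (1 - (tanh (\<Delta> k))\<^sup>2) = (cosh (rad k))\<^sup>2 - c\<^sup>2 * (sinh (rad k))\<^sup>2"
      unfolding tanh_shift by (simp add: tanh_def power_mult_distrib field_simps)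
    also have "\<dots> = 1 + s\<^sup>2 * (sinh (rad k))\<^sup>2"
      by (simp add: cosh_square_eq cos_squared_eq algebra_simps)
    also have "\<dots> = (cosh (rad (Suc k)))\<^sup>2"
      by (simp only: cosh_square_eq sinh_rad_Suc power_mult_distrib add.commute)
    finally show ?thesis .
  qed
  ultimately show "(cosh (rad (Suc k)) * cosh (\<Delta> k))\<^sup>2 = (cosh (rad k))\<^sup>2"
    by (metis mult.assoc mult.commute mult.right_neutral power_mult_distrib)
qed simp_all

section \<open>The points \<open>y k\<close> and the moving frame in coordinates\<close>

lemma mink_E:
  assumes "i \<in> {1..DIM('a)}" "j \<in> {1..DIM('a)}"
  shows "mink (E i) (E j) = (if i = j then 1 else 0)"
proof -
  have "b i \<in> Basis" "b j \<in> Basis" using bij assms by (auto dest: bij_betwE)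
  moreover have "b i = b j \<longleftrightarrow> i = j"
    by (rule inj_on_eq_iff[OF bij_betw_imp_inj_on[OF bij] assms])
  ultimately show ?thesis by (simp add: E_def mink_def inner_Basis)
qed

lemma hexp_E:
  assumes "i \<in> {1..DIM('a)}" "\<delta> > 0"
  shows "hexp p (\<delta> *\<^sub>R E i) = cosh \<delta> *\<^sub>R p + sinh \<delta> *\<^sub>R E i"
  using assms mink_E[of i i] by (simp add: hexp_def mnorm_scaleR) (simp add: mnorm_def)

text \<open>The step from \<open>y k\<close> to \<open>y (Suc k)\<close> only uses direction
  \<open>E (Suc k)\<close>. Later basis vectors stay orthogonal to both end points, so parallel
  transport leaves them fixed.\<close>

lemma moving_frame_facts:
  "k \<le> DIM('a) \<Longrightarrow> y k \<in> hyp \<and> (\<forall>i\<in>{Suc k..DIM('a)}. evec \<theta> r b k i = E i \<and> mink (E i) (y k) = 0)"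
proof (induction k)
  case 0
  show ?case by (auto simp: ypt_def evec_def e0_hyp E_def mink_def e0_def[symmetric]) (simp_all add: e0_def)
next
  case (Suc k)
  then have IH: "y k \<in> hyp" "\<And>i. i \<in> {Suc k..DIM('a)} \<Longrightarrow> evec \<theta> r b k i = E i"
    "\<And>i. i \<in> {Suc k..DIM('a)} \<Longrightarrow> mink (E i) (y k) = 0" by auto
  have k: "Suc k \<in> {1..DIM('a)}" using Suc.prems by simp
  have y': "y (Suc k) = hexp (y k) (\<Delta> k *\<^sub>R E (Suc k))"
    using IH(2)[of "Suc k"] Suc.prems by (simp add: ypt_def evec_def Let_def)
  then have y'': "y (Suc k) = cosh (\<Delta> k) *\<^sub>R y k + sinh (\<Delta> k) *\<^sub>R E (Suc k)"
    using hexp_E[OF k shift_pos] by simp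
  have h: "y (Suc k) \<in> hyp"
    unfolding y' using IH(3)[of "Suc k"] Suc.prems
    by (intro hexp_hyp[OF IH(1)] tangent_closed) (simp add: tangent_def mink_commute)
  have orth: "mink (E i) (y (Suc k)) = 0" if "i \<in> {Suc (Suc k)..DIM('a)}" for i
    using that IH(3)[of i] k by (simp add: y'' mink_simps mink_E)
  have "evec \<theta> r b (Suc k) i = ptrans (y k) (y (Suc k)) (evec \<theta> r b k i)" for i
    by (simp add: evec_def ypt_def Let_def)
  then have "evec \<theta> r b (Suc k) i = E i" if "i \<in> {Suc (Suc k)..DIM('a)}" for i
    using that IH(2)[of i] IH(3)[of i] orth[of i] ptrans_orthogonal[OF IH(1) h] by simp
  then show ?case using h orth by blast
qed

lemma y_hyp: "k \<le> DIM('a) \<Longrightarrow> y k \<in> hyp"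
  and evec_eq: "k < DIM('a) \<Longrightarrow> evec \<theta> r b k (Suc k) = E (Suc k)"
  and mink_E_y: "k < i \<Longrightarrow> i \<le> DIM('a) \<Longrightarrow> mink (E i) (y k) = 0"
  using moving_frame_facts[of k] by auto

lemma y_Suc: "k < DIM('a) \<Longrightarrow> y (Suc k) = cosh (\<Delta> k) *\<^sub>R y k + sinh (\<Delta> k) *\<^sub>R E (Suc k)"
  using evec_eq[of k] hexp_E[of "Suc k" "\<Delta> k" "y k"]
  by (simp add: ypt_def evec_def Let_def shift_pos)

section \<open>Coordinates of the point \<open>xs\<close>\<close>

lemma sphere_facts:
  "x \<in> sphere_set \<theta> r b n \<Longrightarrow> x \<in> hyp \<and> hdist x (y 0) = r \<and>
     (\<forall>k<n. hangle (evec \<theta> r b k (Suc k)) (hlog (y k) x) = \<theta>)"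
  by (induction n) (auto simp: less_Suc_eq)

lemma xs_hyp: "xs \<in> hyp" and hdist_xs_y0: "hdist xs (y 0) = r"
  and hangle_xs: "k < DIM('a) - 1 \<Longrightarrow> hangle (evec \<theta> r b k (Suc k)) (hlog (y k) xs) = \<theta>"
  using sphere_facts[OF xs_sphere] by auto

text \<open>Turns the angle condition of the sphere recursion into a linear coordinate. The distance
  is a hypothesis because it becomes available only inside the induction of
  \<open>p_facts\<close>.\<close>

lemma mink_E_xs_step:
  assumes k: "k < DIM('a) - 1" and D: "hdist (y k) xs = rad k"
  shows "mink (E (Suc k)) xs = c * sinh (rad k)"
proof -
  have y: "y k \<in> hyp" using k by (intro y_hyp) simp
  have E: "E (Suc k) \<in> tangent (y k)" "mnorm (E (Suc k)) = 1"
    using k mink_E_y[of k "Suc k"] mink_E[of "Suc k" "Suc k"]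
    by (simp_all add: tangent_def mnorm_def mink_commute)
  define t where "t = mink (E (Suc k)) (hlog (y k) xs) / (mnorm (E (Suc k)) * mnorm (hlog (y k) xs))"
  have "\<bar>t\<bar> \<le> 1" unfolding t_def
    by (rule hangle_arg_bounded[OF y E(1) hlog_tangent[OF y xs_hyp]])
  moreover have "arccos t = \<theta>"
    using hangle_xs[OF k] k by (simp add: hangle_def t_def evec_eq)
  ultimately have "t = c" by (auto simp: abs_le_iff)
  moreover have "t = mink (E (Suc k)) xs / sinh (rad k)"
    using rad_pos[of k] k mink_E_y[of k "Suc k"]
    by (simp add: t_def E(2) mnorm_hlog[OF y xs_hyp] mink_hlog[OF y xs_hyp] D)
  ultimately show ?thesis using rad_pos[of k] by (simp add: field_simps)
qed

text \<open>For \<open>k \<le> DIM('a) - 1\<close> the subtracted vector is the orthogonal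
  projection of \<open>xs\<close> to the span of \<open>y 0\<close>, ..., \<open>y k\<close>, and
  \<open>p k\<close> is a positive multiple of \<open>hlog (y k) xs\<close>.\<close>

definition p :: "nat \<Rightarrow> real \<times> 'a" where "p k = xs - cosh (rad k) *\<^sub>R y k"

text \<open>A Gram-Schmidt step: \<open>p (Suc k)\<close> arises from \<open>p k\<close> by removing
  its \<open>E (Suc k)\<close>-component, which is orthogonal to all earlier points. Orthogonality
  to \<open>y (Suc k)\<close> then yields its product with \<open>xs\<close>.\<close>

lemma p_facts:
  "k \<le> DIM('a) - 1 \<Longrightarrow> mink (y k) xs = - cosh (rad k) \<and> (\<forall>j\<le>k. mink (p k) (y j) = 0)"
proof (induction k)
  case 0
  have "mink (y 0) xs = - cosh r"
    using cosh_hdist[OF xs_hyp y_hyp[of 0]] hdist_xs_y0 by (simp add: mink_commute)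
  then show ?case using y_hyp[of 0]
    by (simp add: p_def mink_simps hyp_mink_self mink_commute[of xs])
next
  case (Suc k)
  then have kd: "k < DIM('a) - 1" "k < DIM('a)" "Suc k \<le> DIM('a)" by auto
  have IH: "mink (y k) xs = - cosh (rad k)" "\<And>j. j \<le> k \<Longrightarrow> mink (p k) (y j) = 0"
    using Suc by auto
  have "hdist (y k) xs = rad k"
    using IH(1) rad_pos[of k] by (simp add: hdist_def arcosh_cosh_real)
  note Ex = mink_E_xs_step[OF kd(1) this]
  have cc: "cosh (\<Delta> k) \<noteq> 0" by simp
  have cs: "c * sinh (rad k) = cosh (rad (Suc k)) * sinh (\<Delta> k)"
  proof -
    have "c * sinh (rad k) = c * tanh (rad k) * cosh (rad k)" by (simp add: tanh_def)
    also have "\<dots> = c * tanh (rad k) * (cosh (rad (Suc k)) * cosh (\<Delta> k))"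
      by (simp only: cosh_rad_shift)
    finally show ?thesis by (simp add: sinh_shift mult_ac del: radius.simps(2))
  qed
  have p_Suc: "p (Suc k) = p k - (c * sinh (rad k)) *\<^sub>R E (Suc k)"
    unfolding p_def y_Suc[OF kd(2)] cs
    by (simp add: cosh_rad_shift[of k, symmetric] algebra_simps del: radius.simps(2))
  have pE: "mink (p k) (E (Suc k)) = c * sinh (rad k)"
    using Ex mink_E_y[of k "Suc k"] kd
    by (simp add: p_def mink_simps mink_commute[of xs] mink_commute[of "y k"])
  have 1: "mink (p (Suc k)) (y j) = 0" if "j \<le> k" for j
    using IH(2)[OF that] mink_E_y[of j "Suc k"] that kd by (simp add: p_Suc mink_simps)
  moreover have "mink (p (Suc k)) (E (Suc k)) = 0"
    using pE mink_E[of "Suc k" "Suc k"] kd by (simp add: p_Suc mink_simps)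
  ultimately have 2: "mink (p (Suc k)) (y (Suc k)) = 0"
    by (simp add: y_Suc[OF kd(2)] mink_simps)
  then have "mink (y (Suc k)) xs = - cosh (rad (Suc k))"
    by (simp add: p_def mink_simps hyp_mink_self[OF y_hyp[OF kd(3)]] mink_commute[of xs]
        del: radius.simps(2))
  with 1 2 show ?case by (auto simp: le_Suc_eq)
qed

lemma mink_y_xs: "k \<le> DIM('a) - 1 \<Longrightarrow> mink (y k) xs = - cosh (rad k)"
  using p_facts by blast

lemma hdist_y_xs: "k \<le> DIM('a) - 1 \<Longrightarrow> hdist (y k) xs = rad k"
  using rad_pos[of k] by (simp add: hdist_def mink_y_xs arcosh_cosh_real)

lemma mink_E_xs: "k < DIM('a) - 1 \<Longrightarrow> mink (E (Suc k)) xs = c * sinh (rad k)"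
  using mink_E_xs_step hdist_y_xs by simp

text \<open>The linear hull behind \<open>subspace_I\<close>, kept without the intersection with
  \<open>hyp\<close> because subgradients must be located in it as well.\<close>

definition W :: "nat \<Rightarrow> (real \<times> 'a) set" where "W k = span (y ` {0..k})"

lemma y_in_W: "j \<le> k \<Longrightarrow> y j \<in> W k"
  by (auto simp: W_def intro: span_base)

lemma W_mono: "j \<le> k \<Longrightarrow> W j \<subseteq> W k"
  unfolding W_def by (intro span_mono image_mono) auto

lemma W_closed:
  "u \<in> W k \<Longrightarrow> v \<in> W k \<Longrightarrow> u + v \<in> W k"
  "u \<in> W k \<Longrightarrow> v \<in> W k \<Longrightarrow> u - v \<in> W k"
  "u \<in> W k \<Longrightarrow> a *\<^sub>R u \<in> W k"
  by (auto simp: W_def intro: span_add span_diff span_scale)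

lemma mink_p_W: "k \<le> DIM('a) - 1 \<Longrightarrow> x \<in> W k \<Longrightarrow> mink (p k) x = 0"
  unfolding W_def using p_facts[of k] by (elim mink_span_eq_0) auto

lemma mink_E_W: "k < i \<Longrightarrow> i \<le> DIM('a) \<Longrightarrow> x \<in> W k \<Longrightarrow> mink (E i) x = 0"
  unfolding W_def by (elim mink_span_eq_0) (auto simp: mink_E_y)

lemma E_in_W: "k < DIM('a) \<Longrightarrow> E (Suc k) \<in> W (Suc k)"
proof -
  assume k: "k < DIM('a)"
  have "E (Suc k) = (1 / sinh (\<Delta> k)) *\<^sub>R (y (Suc k) - cosh (\<Delta> k) *\<^sub>R y k)"
    using shift_pos[of k] by (simp add: y_Suc[OF k])
  also have "\<dots> \<in> W (Suc k)" by (intro W_closed y_in_W) auto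
  finally show ?thesis .
qed

lemma mink_p_xs: "k \<le> DIM('a) - 1 \<Longrightarrow> mink (p k) xs = (sinh (rad k))\<^sup>2"
  by (simp add: p_def mink_simps mink_y_xs hyp_mink_self xs_hyp sinh_square_eq flip: power2_eq_square)

lemma mink_p_p: "k \<le> DIM('a) - 1 \<Longrightarrow> mink (p k) (p k) = (sinh (rad k))\<^sup>2"
  using mink_p_xs[of k] mink_p_W[of k "y k"] y_in_W[of k k]
  by (subst (2) p_def) (simp add: mink_simps)

section \<open>Normals of the half-spaces\<close>

abbreviation "V \<equiv> normal_V \<theta> r b xs"

lemma V_eq: "k \<le> DIM('a) - 2 \<Longrightarrow> V k = (1 / c) *\<^sub>R E (Suc k) - (1 / sinh (rad k)) *\<^sub>R p k"
  using rad_pos[of k] dim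
  by (simp add: normal_V_def evec_eq hlog_eq[OF y_hyp xs_hyp] hdist_y_xs p_def)

lemma mink_V_W:
  assumes "k \<le> DIM('a) - 2" "x \<in> W k"
  shows "mink (V k) x = 0"
proof -
  have "k \<le> DIM('a) - 1" "Suc k \<le> DIM('a)" using assms(1) dim by auto
  then show ?thesis
    using mink_p_W[of k x] mink_E_W[of k "Suc k" x] assms by (simp add: V_eq mink_simps)
qed

text \<open>The two terms of \<open>V_eq\<close> both pair with \<open>xs\<close> to
  \<open>sinh (rad k)\<close>; the factor \<open>1 / c\<close> is what balances them. Hence
  \<open>xs\<close> lies on every wall.\<close>

lemma mink_V_xs: "k \<le> DIM('a) - 2 \<Longrightarrow> mink (V k) xs = 0"
proof -
  assume k: "k \<le> DIM('a) - 2"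
  then have "k < DIM('a) - 1" "k \<le> DIM('a) - 1" using dim by auto
  then show ?thesis
    using k c_pos rad_pos[of k] by (simp add: V_eq mink_simps mink_E_xs mink_p_xs power2_eq_square)
qed

text \<open>\<open>E (Suc k)\<close> and \<open>p k\<close> divided by \<open>sinh (rad k)\<close>
  are unit vectors at angle \<open>\<theta>\<close>, so the square is
  \<open>1 / c\<^sup>2 - 2 + 1\<close>.\<close>

lemma mnorm_V: "k \<le> DIM('a) - 2 \<Longrightarrow> mnorm (V k) = s / c"
proof -
  assume k: "k \<le> DIM('a) - 2"
  then have kd: "k < DIM('a) - 1" "k \<le> DIM('a) - 1" "Suc k \<in> {1..DIM('a)}" using dim by auto
  have Ep: "mink (E (Suc k)) (p k) = c * sinh (rad k)"
    using kd mink_E_y[of k "Suc k"] by (simp add: p_def mink_simps mink_E_xs)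
  have "mink (V k) (V k) = 1 / c\<^sup>2 - 1"
    using k c_pos rad_pos[of k] mink_E[OF kd(3) kd(3)]
    by (simp add: V_eq mink_simps mink_p_p[OF kd(2)] Ep mink_commute[of "p k" "E (Suc k)"]
        power2_eq_square diff_divide_distrib)
  also have "\<dots> = (s / c)\<^sup>2"
    using c_pos by (simp add: power_divide field_simps sin_squared_eq)
  finally show ?thesis using c_pos s_pos by (simp add: mnorm_def)
qed

definition N :: "nat \<Rightarrow> real \<times> 'a" where "N k = (1 / mnorm (V k)) *\<^sub>R V k"

lemma N_eq: "k \<le> DIM('a) - 2 \<Longrightarrow> N k = (c / s) *\<^sub>R V k"
  by (simp add: N_def mnorm_V)

lemma mink_N_N: "k \<le> DIM('a) - 2 \<Longrightarrow> mink (N k) (N k) = 1"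
proof -
  assume k: "k \<le> DIM('a) - 2"
  have "mnorm (N k) = 1"
    using c_pos s_pos by (simp add: N_eq[OF k] mnorm_scaleR mnorm_V[OF k])
  then show ?thesis by (simp add: mnorm_def)
qed

lemma mink_N_W: "k \<le> DIM('a) - 2 \<Longrightarrow> x \<in> W k \<Longrightarrow> mink (N k) x = 0"
  by (simp add: N_eq mink_simps mink_V_W)

lemma mink_N_xs: "k \<le> DIM('a) - 2 \<Longrightarrow> mink (N k) xs = 0"
  by (simp add: N_eq mink_simps mink_V_xs)

lemma halfspace_eq:
  assumes "k \<le> DIM('a) - 2"
  shows "halfspace_L \<theta> r b xs k = {x \<in> hyp. mink (N k) x \<ge> 0}"
proof -
  have "halfspace_L \<theta> r b xs k = {x \<in> hyp. mink (V k) x \<ge> 0}"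
    unfolding halfspace_L_def
    using assms by (intro hexp_image_halfspace y_hyp mink_V_W y_in_W) auto
  also have "\<dots> = {x \<in> hyp. mink (N k) x \<ge> 0}"
    using c_pos s_pos by (simp add: N_eq[OF assms] mink_simps zero_le_mult_iff zero_le_divide_iff)
  finally show ?thesis .
qed

section \<open>The hard function: minimum and bounded subgradients\<close>

abbreviation "f \<equiv> hard_fun \<theta> r b xs"

lemma f_eq:
  assumes "x \<in> hyp"
  shows "f x = hdist x xs + Max ((\<lambda>i. 1 / c * wall_dist (N i) x) ` {0..DIM('a) - 2})"
proof -
  have "hdist_set x (halfspace_L \<theta> r b xs i) = wall_dist (N i) x" if "i \<in> {0..DIM('a) - 2}" for i
    using that assms by (simp add: halfspace_eq hdist_set_halfspace mink_N_N)
  then have "(\<lambda>i. 1 / c * hdist_set x (halfspace_L \<theta> r b xs i)) ` {0..DIM('a) - 2}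
      = (\<lambda>i. 1 / c * wall_dist (N i) x) ` {0..DIM('a) - 2}"
    by (intro image_cong) auto
  then show ?thesis by (simp add: hard_fun_def)
qed

lemma f_ge:
  assumes "x \<in> hyp" "i \<le> DIM('a) - 2"
  shows "hdist x xs + 1 / c * wall_dist (N i) x \<le> f x"
  unfolding f_eq[OF assms(1)] using assms(2) by (intro add_left_mono Max_ge) auto

lemma f_ge_hdist: "x \<in> hyp \<Longrightarrow> hdist x xs \<le> f x"
  using f_ge[of x 0] wall_dist_nonneg[of "N 0" x] c_pos
  by (smt (verit) divide_nonneg_pos mult_nonneg_nonneg zero_le)

lemma f_eq_hdist:
  assumes "x \<in> hyp" "\<And>i. i \<le> DIM('a) - 2 \<Longrightarrow> mink (N i) x \<ge> 0"
  shows "f x = hdist x xs"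
proof -
  have "(\<lambda>i. 1 / c * wall_dist (N i) x) ` {0..DIM('a) - 2} = {0}"
    using assms(2) by (auto simp: wall_dist_eq_0 image_iff)
  then show ?thesis by (simp add: f_eq[OF assms(1)])
qed

lemma is_arg_min_xs: "is_arg_min f (\<lambda>x. x \<in> hyp) xs" and f_xs: "f xs = 0"
proof -
  show 0: "f xs = 0"
    using f_eq_hdist[OF xs_hyp] by (simp add: mink_N_xs hdist_self xs_hyp)
  show "is_arg_min f (\<lambda>x. x \<in> hyp) xs"
    unfolding is_arg_min_def 0
    using xs_hyp f_ge_hdist hdist_nonneg[OF _ xs_hyp] by (meson dual_order.trans not_less)
qed

text \<open>Adds a subgradient of the distance to one of a wall term attaining the maximum. The norm
  is at most \<open>1 + 1 / c\<close>, and \<open>c \<le> 1\<close>.\<close>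

lemma f_subdiff:
  assumes x: "x \<in> hyp"
  shows "\<exists>g \<in> subdiff f x. mnorm g \<le> 2 / c"
proof -
  let ?A = "(\<lambda>i. 1 / c * wall_dist (N i) x) ` {0..DIM('a) - 2}"
  have "Max ?A \<in> ?A" by (intro Max_in) auto
  then obtain i where "i \<in> {0..DIM('a) - 2}" and Max: "Max ?A = 1 / c * wall_dist (N i) x"
    by (rule imageE)
  then have i: "i \<le> DIM('a) - 2" by simp
  obtain g1 where g1: "g1 \<in> subdiff (\<lambda>y. hdist y xs) x" "mnorm g1 \<le> 1"
    using hdist_subdiff[OF x xs_hyp] by blast
  obtain g2 where g2: "g2 \<in> subdiff (wall_dist (N i)) x" "mnorm g2 \<le> 1"
    using wall_dist_subdiff[OF x mink_N_N[OF i]] by blast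
  have t: "g1 \<in> tangent x" "g2 \<in> tangent x" using g1 g2 by (auto simp: subdiff_def)
  show ?thesis
  proof (rule bexI[where x = "g1 + (1 / c) *\<^sub>R g2"])
    have "mnorm (g1 + (1 / c) *\<^sub>R g2) \<le> mnorm g1 + mnorm ((1 / c) *\<^sub>R g2)"
      by (intro mnorm_triangle[OF x] tangent_closed t)
    also have "\<dots> \<le> 1 + 1 / c"
    proof -
      have "mnorm g2 / c \<le> 1 / c" using g2(2) c_pos by (intro divide_right_mono) auto
      then show ?thesis using g1(2) c_pos by (simp add: mnorm_scaleR)
    qed
    also have "\<dots> \<le> 2 / c" using c_pos by (simp add: field_simps)
    finally show "mnorm (g1 + (1 / c) *\<^sub>R g2) \<le> 2 / c" .
    have "f x + mink (g1 + (1 / c) *\<^sub>R g2) (hlog x z) \<le> f z" if z: "z \<in> hyp" for z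
    proof -
      have "hdist x xs + mink g1 (hlog x z) \<le> hdist z xs" using g1(1) z by (simp add: subdiff_def)
      moreover have "1 / c * (wall_dist (N i) x + mink g2 (hlog x z)) \<le> 1 / c * wall_dist (N i) z"
        using g2(1) z c_pos by (intro mult_left_mono) (simp_all add: subdiff_def)
      ultimately show ?thesis
        using f_ge[OF z i] unfolding f_eq[OF x] Max by (simp add: mink_simps distrib_left)
    qed
    then show "g1 + (1 / c) *\<^sub>R g2 \<in> subdiff f x"
      by (auto simp: subdiff_def intro!: tangent_closed t)
  qed
qed

section \<open>The hard subgradient\<close>

abbreviation "hgrad \<equiv> hard_grad \<theta> r b xs"

text \<open>The triangle \<open>x\<close>, \<open>y (Suc k)\<close>, \<open>xs\<close> has a right
  angle at \<open>y (Suc k)\<close>, because \<open>p (Suc k)\<close> is orthogonal to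
  \<open>W (Suc k)\<close>. Pythagoras gives the hypotenuse, and the law of sines the angle at
  \<open>x\<close>.\<close>

lemma x_xs_right_triangle:
  assumes k: "k \<le> DIM('a) - 2" and x: "x \<in> hyp" "x \<in> W k"
  shows "hdist x xs > 0"
    and "sin (hangle (hlog x (y (Suc k))) (hlog x xs)) = sinh (rad (Suc k)) / sinh (hdist x xs)"
proof -
  define a where "a = hdist x (y (Suc k))"
  define D where "D = hdist x xs"
  define \<rho> where "\<rho> = rad (Suc k)"
  have kd: "Suc k \<le> DIM('a) - 1" "Suc k \<le> DIM('a)" "k < DIM('a)" using k dim by auto
  have yh: "y (Suc k) \<in> hyp" using kd by (intro y_hyp)
  have \<rho>: "\<rho> > 0" unfolding \<rho>_def by (rule rad_pos)
  have "mink (p (Suc k)) x = 0"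
    using kd x W_mono[of k "Suc k"] by (intro mink_p_W) auto
  then have xx: "mink x xs = cosh \<rho> * mink x (y (Suc k))"
    by (simp add: p_def mink_simps \<rho>_def mink_commute[of _ x] del: radius.simps(2))
  have xy: "mink x (y (Suc k)) = - cosh a" and xD: "mink x xs = - cosh D"
    using cosh_hdist[OF x(1) yh] cosh_hdist[OF x(1) xs_hyp] by (simp_all add: a_def D_def)
  have cD: "cosh D = cosh \<rho> * cosh a" using xx xy xD by simp
  have "mink (E (Suc k)) x = 0" using kd x by (intro mink_E_W[of k]) auto
  moreover have "mink (E (Suc k)) (y (Suc k)) = sinh (\<Delta> k)"
    using kd mink_E_y[of k "Suc k"] mink_E[of "Suc k" "Suc k"] by (simp add: y_Suc mink_simps)
  \<comment> \<open>Keeps the triangle nondegenerate, so that the angle at \<open>x\<close> has its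
    usual meaning.\<close>
  ultimately have "x \<noteq> y (Suc k)" using shift_pos[of k] by auto
  then have a: "a > 0"
    using hdist_nonneg[OF x(1) yh] hdist_eq_0_iff[OF x(1) yh] by (simp add: a_def)
  have "1 * 1 < cosh \<rho> * cosh a"
    using \<rho> a cosh_real_nonneg_less_iff[of 0 \<rho>] cosh_real_nonneg_less_iff[of 0 a]
    by (intro mult_strict_mono) auto
  then have "D \<noteq> 0" using cD by auto
  then show D: "hdist x xs > 0"
    using hdist_nonneg[OF x(1) xs_hyp] by (simp add: D_def)
  then have sD: "sinh D > 0" by (simp add: D_def)
  have yx: "mink (y (Suc k)) xs = - cosh \<rho>" using mink_y_xs[OF kd(1)] by (simp add: \<rho>_def)
  have "mink (y (Suc k) - cosh a *\<^sub>R x) (xs - cosh D *\<^sub>R x) = cosh a * cosh D - cosh \<rho>"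
    by (simp add: mink_simps yx xD mink_commute[of "y (Suc k)" x] xy hyp_mink_self[OF x(1)])
  also have "\<dots> = cosh \<rho> * (sinh a)\<^sup>2"
    unfolding cD sinh_square_eq by (simp add: power2_eq_square algebra_simps)
  finally have m: "mink (y (Suc k) - cosh a *\<^sub>R x) (xs - cosh D *\<^sub>R x) = cosh \<rho> * (sinh a)\<^sup>2" .
  define t where "t = mink (hlog x (y (Suc k))) (hlog x xs) / (mnorm (hlog x (y (Suc k))) * mnorm (hlog x xs))"
  have t1: "\<bar>t\<bar> \<le> 1" unfolding t_def
    by (intro hangle_arg_bounded[OF x(1)] hlog_tangent x yh xs_hyp)
  have "mink (hlog x (y (Suc k))) (hlog x xs) = (a / sinh a) * (D / sinh D) * (cosh \<rho> * (sinh a)\<^sup>2)"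
    unfolding m[symmetric]
    unfolding hlog_eq[OF x(1) yh] hlog_eq[OF x(1) xs_hyp] a_def D_def
    by (simp only: mink_simps(5,6) mult_ac)
  then have t: "t = cosh \<rho> * sinh a / sinh D"
    using a D sD
    by (simp add: t_def mnorm_hlog x yh xs_hyp a_def[symmetric] D_def[symmetric] power2_eq_square)
  have "(sinh D)\<^sup>2 - (cosh \<rho> * sinh a)\<^sup>2 = (sinh \<rho>)\<^sup>2"
    by (simp add: sinh_square_eq cD power_mult_distrib algebra_simps)
  moreover have "1 - t\<^sup>2 = ((sinh D)\<^sup>2 - (cosh \<rho> * sinh a)\<^sup>2) / (sinh D)\<^sup>2"
    using sD by (simp add: t power_divide diff_divide_distrib)
  ultimately have "1 - t\<^sup>2 = (sinh \<rho> / sinh D)\<^sup>2"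
    by (simp add: power_divide)
  then have "sin (arccos t) = sinh \<rho> / sinh D"
    using t1 \<rho> sD by (simp add: sin_arccos abs_le_iff)
  then show "sin (hangle (hlog x (y (Suc k))) (hlog x xs)) = sinh (rad (Suc k)) / sinh (hdist x xs)"
    by (simp add: hangle_def t_def[symmetric] \<rho>_def D_def del: radius.simps(2))
qed

lemma hgrad_eq:
  assumes k: "k \<le> DIM('a) - 2" and x: "x \<in> hyp" "x \<in> W k"
  shows "hgrad k x = - ((sinh (rad (Suc k)) / sinh (hdist x xs) / c) *\<^sub>R N k)
    - (1 / hdist x xs) *\<^sub>R hlog x xs"
proof -
  have yh: "y k \<in> hyp" using k by (intro y_hyp) simp
  have "ptrans (y k) x (N k) = N k"
    using mink_N_W[OF k] x y_in_W[of k k] by (intro ptrans_orthogonal yh x) auto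
  then show ?thesis
    unfolding hard_grad_def Let_def x_xs_right_triangle(2)[OF assms] N_def[symmetric] by simp
qed

text \<open>The wall part contributes \<open>xs\<close> with coefficient \<open>1 / sinh D\<close>
  through \<open>p k\<close>, the distance part with the opposite coefficient. What remains involves
  only \<open>x\<close>, \<open>y k\<close> and the new direction \<open>E (Suc k)\<close>.\<close>

lemma hgrad_in_W:
  assumes k: "k \<le> DIM('a) - 2" and x: "x \<in> hyp" "x \<in> W k"
  shows "hgrad k x \<in> W (Suc k)"
proof -
  define D where "D = hdist x xs"
  have D: "D > 0" using x_xs_right_triangle(1)[OF assms] by (simp add: D_def)
  have kd: "k < DIM('a)" using k dim by simp
  \<comment> \<open>The factor \<open>s\<close> of the radius recursion cancels the normalisation
    \<open>c / s\<close> of \<open>N k\<close>.\<close>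
  have 1: "(sinh (rad (Suc k)) / sinh D / c) *\<^sub>R N k
      = (sinh (rad k) / sinh D) *\<^sub>R ((1 / c) *\<^sub>R E (Suc k) - (1 / sinh (rad k)) *\<^sub>R p k)"
    unfolding sinh_rad_Suc N_eq[OF k] V_eq[OF k, symmetric] using c_pos s_pos by simp
  have 2: "(1 / D) *\<^sub>R hlog x xs = (1 / sinh D) *\<^sub>R (xs - cosh D *\<^sub>R x)"
    using D by (simp add: hlog_eq[OF x(1) xs_hyp] D_def)
  have "hgrad k x = (cosh D / sinh D) *\<^sub>R x - (sinh (rad k) / sinh D / c) *\<^sub>R E (Suc k)
      - (cosh (rad k) / sinh D) *\<^sub>R y k"
    unfolding hgrad_eq[OF assms] D_def[symmetric] 1 2
    using rad_pos[of k] by (simp add: p_def algebra_simps)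
  also have "\<dots> \<in> W (Suc k)"
    using x W_mono[of k "Suc k"] by (intro W_closed E_in_W y_in_W kd) auto
  finally show ?thesis .
qed

text \<open>Inside all half-spaces \<open>f x\<close> is just the distance, and \<open>x\<close>
  lies on wall \<open>k\<close>. So the wall part is a boundary subgradient with coefficient
  \<open>l\<close> in the unit interval, and \<open>f\<close> dominates the distance plus this
  single wall term.\<close>

lemma hgrad_subdiff:
  assumes k: "k \<le> DIM('a) - 2" and x: "x \<in> hyp" "x \<in> W k"
    and L: "\<And>i. i \<le> DIM('a) - 2 \<Longrightarrow> mink (N i) x \<ge> 0"
  shows "hgrad k x \<in> subdiff f x"
proof -
  define l where "l = sinh (rad (Suc k)) / sinh (hdist x xs)"
  have l: "0 \<le> l"
    using x_xs_right_triangle(1)[OF k x] rad_pos[of "Suc k"]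
    by (simp add: l_def less_imp_le del: radius.simps(2))
  have l1: "l \<le> 1"
    unfolding l_def x_xs_right_triangle(2)[OF k x, symmetric] by (rule sin_le_one)
  have g: "hgrad k x = - ((l / c) *\<^sub>R N k) + - (1 / hdist x xs) *\<^sub>R hlog x xs"
    unfolding hgrad_eq[OF k x] l_def by simp
  have Nx: "mink (N k) x = 0" by (rule mink_N_W[OF k x(2)])
  have Nt: "N k \<in> tangent x"
    using Nx by (simp add: tangent_def mink_commute)
  have "- ((l / c) *\<^sub>R N k) = (- (l / c)) *\<^sub>R N k" by simp
  then have "hgrad k x \<in> tangent x"
    unfolding g using Nt hlog_tangent[OF x(1) xs_hyp] by (auto intro!: tangent_closed simp del: scaleR_minus_left)
  moreover have "f x + mink (hgrad k x) (hlog x z) \<le> f z" if z: "z \<in> hyp" for z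
  proof -
    have "1 / c * - (l * mink (N k) (hlog x z)) \<le> 1 / c * wall_dist (N k) z"
      using wall_dist_boundary_subgradient[OF x(1) z mink_N_N[OF k] Nx l l1] c_pos
      by (intro mult_left_mono) auto
    moreover have "hdist x xs + mink (- (1 / hdist x xs) *\<^sub>R hlog x xs) (hlog x z) \<le> hdist z xs"
      by (rule hdist_subgradient[OF x(1) z xs_hyp])
    moreover have "f x = hdist x xs" by (rule f_eq_hdist[OF x(1) L])
    ultimately show ?thesis
      using f_ge[OF z k] by (simp add: g mink_simps)
  qed
  ultimately show ?thesis by (auto simp: subdiff_def)
qed

section \<open>The oracle and the location of the iterates\<close>

definition hard_query :: "nat \<Rightarrow> real \<times> 'a \<Rightarrow> bool" where
  "hard_query j x \<longleftrightarrow> j \<le> DIM('a) - 2 \<and>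
     x \<in> subspace_I \<theta> r b j \<inter> (\<Inter>l\<in>{0..DIM('a) - 2}. halfspace_L \<theta> r b xs l)"

text \<open>Any fixed choice of the free subgradients serves, as A2 is imposed for all of
  them.\<close>

definition hard_oracle :: "(real \<times> 'a) oracle_fun" where
  "hard_oracle j x = (f x, if hard_query j x then hgrad j x else SOME g. g \<in> subdiff f x)"

lemma hard_query_iff:
  "hard_query j x \<longleftrightarrow> j \<le> DIM('a) - 2 \<and> x \<in> hyp \<and> x \<in> W j \<and> (\<forall>l\<le>DIM('a) - 2. mink (N l) x \<ge> 0)"
  by (auto simp: hard_query_def subspace_I_def gspan_def W_def halfspace_eq)

lemma some_subdiff: "x \<in> hyp \<Longrightarrow> (SOME g. g \<in> subdiff f x) \<in> subdiff f x"
  using f_subdiff[of x] by (metis someI)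

lemma is_oracle_hard_oracle: "is_oracle f hard_oracle"
  using some_subdiff hgrad_subdiff by (auto simp: is_oracle_def hard_oracle_def hard_query_iff)

lemma is_hard_oracle_hard_oracle: "is_hard_oracle \<theta> r b xs f hard_oracle"
  unfolding is_hard_oracle_def hard_query_def[symmetric]
  using some_subdiff by (auto simp: hard_oracle_def)

text \<open>By strong induction every earlier query \<open>l\<close> is a hard query, so its answer
  lies in \<open>W (Suc l)\<close>, hence in \<open>W k\<close>; A1 then confines the next query to
  \<open>W k\<close>.\<close>

lemma iterate_in_W:
  assumes A1: "assumption_A1 f A" and A2: "assumption_A2 \<theta> r b xs f A"
  shows "k \<le> DIM('a) - 1 \<Longrightarrow> iterate A hard_oracle k \<in> hyp \<inter> W k"
proof (induction k rule: less_induct)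
  case (less k)
  let ?x = "iterate A hard_oracle" and ?g = "answer_grad A hard_oracle"
  show ?case
  proof (cases "k = 0")
    case True
    have "?x 0 = y 0"
      using A1 is_oracle_hard_oracle by (simp add: assumption_A1_def ypt_def)
    then show ?thesis using True y_hyp[of 0] y_in_W[of 0 0] by simp
  next
    case False
    have mem: "?x l \<in> W k \<and> ?g l \<in> W k" if l: "l < k" for l
    proof -
      have ld: "l \<le> DIM('a) - 2" "l \<le> DIM('a) - 1" using l less.prems by auto
      have x: "?x l \<in> hyp" "?x l \<in> W l" using less.IH[OF l ld(2)] by auto
      have "mink (N i) (?x l) \<ge> 0" if i: "i \<le> DIM('a) - 2" for i
      \<comment> \<open>Half-spaces with smaller index come from A2; for \<open>i \<ge> l\<close>
        the point lies on the wall since \<open>W l\<close> is contained in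
        \<open>W i\<close>.\<close>
      proof (cases "i < l")
        case True
        have "?x l \<in> halfspace_L \<theta> r b xs i"
          using A2 is_hard_oracle_hard_oracle ld(2) True by (auto simp: assumption_A2_def)
        then show ?thesis using halfspace_eq[OF i] by simp
      next
        case False
        then show ?thesis using mink_N_W[OF i, of "?x l"] x W_mono[of l i] by auto
      qed
      then have "hard_query l (?x l)" using ld x by (simp add: hard_query_iff)
      then have "?g l = hgrad l (?x l)" by (simp add: answer_grad_def hard_oracle_def)
      then have "?g l \<in> W (Suc l)" using hgrad_in_W[OF ld(1) x] by simp
      then show ?thesis using x W_mono[of l k] W_mono[of "Suc l" k] l by auto
    qed
    have "?x k \<in> gspan (?x ` {..<k} \<union> ?g ` {..<k})"
      using A1 is_oracle_hard_oracle False by (simp add: assumption_A1_def)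
    moreover have "span (?x ` {..<k} \<union> ?g ` {..<k}) \<subseteq> W k"
      unfolding W_def by (intro span_minimal subspace_span) (use mem in \<open>auto simp: W_def\<close>)
    ultimately show ?thesis by (auto simp: gspan_def)
  qed
qed

text \<open>Pythagoras with foot point \<open>y k\<close>: \<open>cosh\<close> of the distance is
  \<open>cosh (rad k)\<close> times a factor of at least 1.\<close>

lemma hdist_xs_ge_rad:
  assumes k: "k \<le> DIM('a) - 1" and x: "x \<in> hyp" "x \<in> W k"
  shows "rad k \<le> hdist x xs"
proof -
  have yh: "y k \<in> hyp" using k by (intro y_hyp) simp
  have "mink x xs = cosh (rad k) * mink x (y k)"
    using mink_p_W[OF k x(2)] by (simp add: p_def mink_simps mink_commute[of _ x])
  then have "cosh (hdist x xs) = cosh (rad k) * - mink x (y k)"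
    using cosh_hdist[OF x(1) xs_hyp] by simp
  moreover have "cosh (rad k) * 1 \<le> cosh (rad k) * - mink x (y k)"
    using hyp_mink_le[OF x(1) yh] by (intro mult_left_mono) auto
  ultimately have "cosh (rad k) \<le> cosh (hdist x xs)" by simp
  then show ?thesis
    using rad_pos[of k] hdist_nonneg[OF x(1) xs_hyp] by (subst (asm) cosh_real_nonneg_le_iff) auto
qed

lemma rad_antimono:
  assumes "j \<le> k"
  shows "rad k \<le> rad j"
proof -
  have "s ^ k \<le> s ^ j" using assms s_pos by (intro power_decreasing) auto
  then have "sinh (rad k) \<le> sinh (rad j)"
    unfolding sinh_rad using r_pos by (intro mult_right_mono) auto
  then show ?thesis by simp
qed

end

theorem theorem29:
  fixes r \<epsilon> \<theta> M :: real
    and T d :: nat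
    and b :: "nat \<Rightarrow> 'a::euclidean_space"
    and xstar :: "real \<times> 'a"
    and f :: "real \<times> 'a \<Rightarrow> real"
  assumes "r > 0"
    and "0 < \<epsilon>" and "\<epsilon> \<le> 1 / (4 * sqrt 2)"
    and "T = d" and "int d = \<lfloor>1 / 32 * (zeta r / \<epsilon>\<^sup>2)\<rfloor>"
    and "DIM('a) = d" and "d \<ge> 2"
    and "bij_betw b {1..d} Basis"
    and "0 < \<theta>" and "\<theta> < pi / 2" and "\<epsilon> = 1 / 4 * cos \<theta>"
    and "M = 2 / cos \<theta>"
    and "xstar \<in> sphere_set \<theta> r b (d - 1)"
    and "f = hard_fun \<theta> r b xstar"
  shows "g_convex f \<and> g_lipschitz M f \<and>
    (\<exists>z. is_arg_min f (\<lambda>x. x \<in> hyp) z \<and>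
      (\<forall>A :: (real \<times> 'a) algorithm.
        assumption_A1 f A \<and> assumption_A2 \<theta> r b xstar f A \<longrightarrow>
        (\<exists>Or. is_oracle f Or \<and> (\<forall>k \<in> {0..<T}. f (iterate A Or k) - f z \<ge> \<epsilon> * M * r))))"
proof -
  interpret H: hard_instance \<theta> r b xstar
    using assms by unfold_locales auto
  have f: "f = hard_fun \<theta> r b xstar" by fact
  have convex: "g_convex f"
    unfolding f using H.f_subdiff by (intro g_convex_if_subdiff_nonempty) auto
  have lipschitz: "g_lipschitz M f"
    unfolding f \<open>M = 2 / cos \<theta>\<close> using H.f_subdiff by (intro g_lipschitz_if_bounded_subgradients) auto
  have c: "cos \<theta> > 0" by (rule H.c_pos)
  \<comment> \<open>The required gap is therefore \<open>r / 2\<close>.\<close>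
  have \<epsilon>M: "\<epsilon> * M = 1 / 2" using c assms by simp
  have "cos \<theta> \<le> 1 / sqrt 2" using assms by simp
  then have "(cos \<theta>)\<^sup>2 \<le> (1 / sqrt 2)\<^sup>2" using c by (intro power_mono) auto
  then have c2: "(cos \<theta>)\<^sup>2 \<le> 1 / 2" by (simp add: power_divide)
  have "real d \<le> 1 / 32 * (zeta r / \<epsilon>\<^sup>2)"
    using \<open>int d = _\<close> of_int_floor_le[of "1 / 32 * (zeta r / \<epsilon>\<^sup>2)"] by (metis of_int_of_nat_eq)
  also have "\<dots> = zeta r / (2 * (cos \<theta>)\<^sup>2)"
    using c by (simp add: \<open>\<epsilon> = _\<close> power_divide power_mult_distrib field_simps)
  finally have "real d * (cos \<theta>)\<^sup>2 \<le> zeta r / 2" using c by (simp add: field_simps)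
  \<comment> \<open>The last iterate considered has index \<open>T - 1 = d - 1\<close>, and radii
    decrease, so the radius of index \<open>d - 1\<close> decides.\<close>
  moreover have "real (d - 1) * (cos \<theta>)\<^sup>2 \<le> real d * (cos \<theta>)\<^sup>2" by (intro mult_right_mono) auto
  ultimately have "real (d - 1) * (cos \<theta>)\<^sup>2 \<le> zeta r / 2" by linarith
  then have "sinh (r / 2) \<le> sinh (radius \<theta> r (d - 1))"
    unfolding H.sinh_rad using assms c2 by (intro sin_power_lower_bound) auto
  then have r2: "r / 2 \<le> radius \<theta> r (d - 1)" by simp
  have "f (iterate A H.hard_oracle k) - f xstar \<ge> \<epsilon> * M * r"
    if A: "assumption_A1 f A" "assumption_A2 \<theta> r b xstar f A" and k: "k \<in> {0..<T}" for A k
  proof -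
    let ?x = "iterate A H.hard_oracle k"
    have kd: "k \<le> d - 1" using k assms by simp
    have x: "?x \<in> hyp" "?x \<in> H.W k"
      using H.iterate_in_W[of A k] A kd assms by auto
    have "r / 2 \<le> radius \<theta> r k" using r2 H.rad_antimono[OF kd] by linarith
    also have "\<dots> \<le> hdist ?x xstar" using H.hdist_xs_ge_rad[OF _ x] kd assms by simp
    also have "\<dots> \<le> f ?x" using H.f_ge_hdist[OF x(1)] f by simp
    finally show ?thesis using H.f_xs f unfolding \<epsilon>M by simp
  qed
  then show ?thesis
    using convex lipschitz H.is_arg_min_xs H.is_oracle_hard_oracle f by blast
qed

end
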